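(* Let $n\ge2$ be an integer and $1<p<n$. If $f:\mathbb{R}_+\to\mathbb{R}_+$ is continuous and satisfies $\liminf_{x\to0^+}f(x)>0$, then the anisotropic equation $-\Delta_p^H u=f(u)$ in $\mathbb{R}^n$ admits no positive supersolution.
   Context: $\mathbb{R}_+=(0,\infty)$. $H\in C^2(\mathbb{R}^n\setminus\{0\})\cap C(\mathbb{R}^n)$ is a fixed positively homogeneous function of degree one ($H(t\xi)=tH(\xi)$ for $t>0$, $H(0)=0$), positive on $\mathbb{S}^{n-1}$ (not assumed even), and uniformly convex, i.e. the unit ball $\{\xi: H(\xi)<1\}$ is uniformly convex (its boundary has principal curvatures bounded below by a positive constant). Set $a(\xi)=\frac1p\nabla_\xi H^p(\xi)$ (with $a(0)=0$) and $\Delta_p^H u=\operatorname{div}(a(\nabla u))$. A supersolution of $-\Delta_p^H u=f(u)$ in $\mathbb{R}^n$ is a function $u\in W^{1,p}_{\mathrm{loc}}(\mathbb{R}^n)\cap C(\mathbb{R}^n)$ such that $\int_{\mathbb{R}^n}a(\nabla u)\cdot\nabla\varphi\ge\int_{\mathbb{R}^n}f(u)\varphi$ for all $\varphi\in C_c^\infty(\mathbb{R}^n)$ with $\varphi\ge0$. It is positive if $u>0$ in $\mathbb{R}^n$. *)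

theory Defs
  imports "HOL-Analysis.Analysis"
begin

definition gradient :: "('a::euclidean_space \<Rightarrow> real) \<Rightarrow> 'a \<Rightarrow> 'a" where
  "gradient f x = (THE D. GDERIV f x :> D)"

(* f \<in> C^k(S); intended for open S, since derivatives are taken in the full neighbourhood
   filter of each point. *)
primrec Ck_on :: "nat \<Rightarrow> 'a::euclidean_space set \<Rightarrow> ('a \<Rightarrow> real) \<Rightarrow> bool" where
  "Ck_on 0 S f \<longleftrightarrow> continuous_on S f"
| "Ck_on (Suc k) S f \<longleftrightarrow>
     (\<forall>x\<in>S. f differentiable (at x)) \<and> (\<forall>b\<in>Basis. Ck_on k S (\<lambda>x. gradient f x \<bullet> b))"

definition test_function :: "('a::euclidean_space \<Rightarrow> real) \<Rightarrow> bool" where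
  "test_function \<phi> \<longleftrightarrow> (\<forall>k. Ck_on k UNIV \<phi>) \<and> compact (closure {x. \<phi> x \<noteq> 0})"

definition Lp_loc :: "real \<Rightarrow> ('a::euclidean_space \<Rightarrow> 'b::euclidean_space) \<Rightarrow> bool" where
  "Lp_loc p f \<longleftrightarrow> f \<in> borel_measurable lebesgue \<and>
     (\<forall>K. compact K \<longrightarrow> set_integrable lebesgue K (\<lambda>x. norm (f x) powr p))"

definition has_weak_gradient ::
    "('a::euclidean_space \<Rightarrow> real) \<Rightarrow> ('a \<Rightarrow> 'a) \<Rightarrow> bool" where
  "has_weak_gradient u G \<longleftrightarrow> Lp_loc 1 u \<and> Lp_loc 1 G \<and>
     (\<forall>\<phi>. test_function \<phi> \<longrightarrow> (\<forall>b\<in>Basis.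
        (\<integral>x. u x * (gradient \<phi> x \<bullet> b) \<partial>lebesgue) = - (\<integral>x. (G x \<bullet> b) * \<phi> x \<partial>lebesgue)))"

(* u \<in> W^{1,p}_loc with weak gradient G; G is determined by u up to a null set. *)
definition W1p_loc_with_gradient ::
    "real \<Rightarrow> ('a::euclidean_space \<Rightarrow> real) \<Rightarrow> ('a \<Rightarrow> 'a) \<Rightarrow> bool" where
  "W1p_loc_with_gradient p u G \<longleftrightarrow> has_weak_gradient u G \<and> Lp_loc p u \<and> Lp_loc p G"

definition gauss_map :: "('a::euclidean_space \<Rightarrow> real) \<Rightarrow> 'a \<Rightarrow> 'a" where
  "gauss_map H x = gradient H x /\<^sub>R norm (gradient H x)"

(* \<kappa> is a principal curvature, at \<xi>, of the level set of H through \<xi>: an eigenvalue of the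
   shape operator, i.e. of the differential of the unit normal on the tangent space.  As the
   normal points out of the sublevel set, spheres bounding balls have positive curvatures. *)
definition principal_curvature :: "('a::euclidean_space \<Rightarrow> real) \<Rightarrow> 'a \<Rightarrow> real \<Rightarrow> bool" where
  "principal_curvature H \<xi> \<kappa> \<longleftrightarrow> (\<exists>v. v \<noteq> 0 \<and> v \<bullet> gradient H \<xi> = 0 \<and>
     frechet_derivative (gauss_map H) (at \<xi>) v = \<kappa> *\<^sub>R v)"

definition uniformly_convex_unit_ball :: "('a::euclidean_space \<Rightarrow> real) \<Rightarrow> bool" where
  "uniformly_convex_unit_ball H \<longleftrightarrow>
     (\<exists>c>0. \<forall>\<xi> \<in> frontier {\<eta>. H \<eta> < 1}. \<forall>\<kappa>. principal_curvature H \<xi> \<kappa> \<longrightarrow> c \<le> \<kappa>)"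

definition aniso_flux ::
    "('a::euclidean_space \<Rightarrow> real) \<Rightarrow> real \<Rightarrow> 'a \<Rightarrow> 'a" where
  "aniso_flux H p \<xi> = (if \<xi> = 0 then 0 else (1 / p) *\<^sub>R gradient (\<lambda>\<eta>. H \<eta> powr p) \<xi>)"

definition supersolution ::
    "('a::euclidean_space \<Rightarrow> real) \<Rightarrow> real \<Rightarrow> (real \<Rightarrow> real) \<Rightarrow> ('a \<Rightarrow> real) \<Rightarrow> bool" where
  "supersolution H p f u \<longleftrightarrow> continuous_on UNIV u \<and>
     (\<exists>G. W1p_loc_with_gradient p u G \<and>
       (\<forall>\<phi>. test_function \<phi> \<and> (\<forall>x. 0 \<le> \<phi> x) \<longrightarrow>
          (\<integral>x. aniso_flux H p (G x) \<bullet> gradient \<phi> x \<partial>lebesgue) \<ge> (\<integral>x. f (u x) * \<phi> x \<partial>lebesgue)))"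

end

theory Submission
  imports Defs
begin

text \<open>
  Write \<open>h(t) = exp(-1/t)\<close> for \<open>t > 0\<close>, \<open>h(t) = 0\<close> otherwise, let \<open>k = u(0) + 1\<close>, and test the
  inequality with \<open>w \<eta>\<close>, where \<open>w = h(k - u)\<close> and \<open>\<eta>(x) = h(1 - |x|^2/R^2)\<close>.
  On \<open>{w > 0}\<close> we have \<open>0 < u < k\<close>, hence \<open>f(u) \<ge> c\<close> and \<open>h'(k - u) \<ge> w/k^2\<close>; the latter makes the
  gradient term coercive, and absorbing the cross term \<open>w a(\<nabla>u) \<bullet> \<nabla>\<eta>\<close> gives
  \<open>I(R/2) \<le> K R^(-p) I(R)\<close> for \<open>I(R) = \<integral>\<^bsub>|x| \<le> R\<^esub> w\<close>. Since \<open>w \<le> 1\<close>, \<open>I\<close> grows at most like \<open>R^n\<close>,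
  so iterating forces \<open>I(R) = 0\<close> for large \<open>R\<close>, contradicting \<open>w(0) > 0\<close>.
  As test functions must be smooth, \<open>u\<close> is first replaced by its mollifications \<open>u\<^sub>n\<close> inside \<open>w\<close>;
  the limit only requires \<open>|\<nabla>u|^(p-1) |\<nabla>u\<^sub>n - \<nabla>u| \<rightarrow> 0\<close> in \<open>L^1\<close> on balls.
\<close>

section \<open>Smooth functions\<close>

text \<open>The profile exp(-1/t) serves in both factors because it is smooth and obeys two opposite
  bounds. From below, h'(t) = h(t)/t^2 is at least h(t)/k^2 for 0 < t \<le> k, which makes the
  truncation coercive. From above, h' \<le> 2 p^2 h^((p-1)/p), so the cutoff satisfies |grad \<eta>|
  \<le> L \<eta>^((p-1)/p) with L of order 1/R. The usual source of the second bound is the p-th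
  power of a cutoff, whose smoothness is doubtful for non-integer p; here one profile gives it for
  every p > 1. Young's inequality with a parameter proportional to \<eta> then absorbs the cross
  term pointwise and leaves a multiple of R^(-p) w in which \<eta> no longer occurs. The truncation
  at a level k is forced by f, which is bounded away from 0 only on intervals (0, k]: by the liminf
  near 0 and by compactness beyond. Most of the work is regularity. Since a(\<xi>) grows like
  |\<xi>|^(p-1) and h' is bounded, replacing u by a mollification leaves a single term containing
  its gradient that is not handled by dominated convergence; hence the weighted L^1
  convergence.\<close>

lemma gradient_eqI:
  assumes "GDERIV f x :> D"
  shows "gradient f x = D"
  unfolding gradient_def
proof (rule the_equality)
  fix E assume "GDERIV f x :> E"
  then have "(\<lambda>h. h \<bullet> E) = (\<lambda>h. h \<bullet> D)"
    using assms unfolding gderiv_def by (rule has_derivative_unique)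
  then show "E = D"
    by (metis inner_commute vector_eq_ldot)
qed (fact assms)

lemma GDERIV_gradient:
  fixes f :: "'a::euclidean_space \<Rightarrow> real"
  assumes "f differentiable (at x)"
  shows "GDERIV f x :> gradient f x"
proof -
  obtain f' where f': "(f has_derivative f') (at x)"
    using assms by (auto simp: differentiable_def)
  \<comment> \<open>The Riesz vector of a real-valued linear map is its adjoint applied to
    1.\<close>
  have "GDERIV f x :> adjoint f' 1"
    unfolding gderiv_def
    using f' by (simp add: adjoint_works has_derivative_linear)
  then show ?thesis
    by (simp add: gradient_eqI)
qed

lemma GDERIV_imp_differentiable: "GDERIV f x :> D \<Longrightarrow> f differentiable (at x)"
  unfolding gderiv_def by (rule differentiableI)

lemma Ck_on_Suc_UNIV_I:
  assumes "\<And>x. GDERIV f x :> g x" and "\<And>b. b \<in> Basis \<Longrightarrow> Ck_on k UNIV (\<lambda>x. g x \<bullet> b)"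
  shows "Ck_on (Suc k) UNIV f"
  using assms(2) by (simp add: gradient_eqI[OF assms(1)] GDERIV_imp_differentiable[OF assms(1)])

text \<open>The recursion in \<open>Ck_on\<close> speaks only of the partial derivatives, so lower
  orders have to be recovered by induction; the base case is that differentiability gives
  continuity.\<close>

lemma Ck_on_SucD: "Ck_on (Suc k) UNIV f \<Longrightarrow> Ck_on k UNIV f"
proof (induction k arbitrary: f)
  case 0
  then show ?case
    by (auto intro!: differentiable_imp_continuous_on simp: differentiable_on_def)
next
  case (Suc k)
  have "Ck_on k UNIV (\<lambda>x. gradient f x \<bullet> b)" if "b \<in> Basis" for b
    using Suc.prems that Ck_on.simps(2)[of "Suc k" UNIV f] by (intro Suc.IH) blast
  moreover have "f differentiable (at x)" for x
    using Suc.prems by simp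
  ultimately show ?case
    using Ck_on.simps(2)[of k UNIV f] by blast
qed

lemma Ck_on_imp_continuous: "Ck_on k UNIV f \<Longrightarrow> continuous_on UNIV f"
proof (induction k)
  case (Suc k)
  from Suc.prems have "Ck_on k UNIV f"
    by (rule Ck_on_SucD)
  then show ?case
    by (rule Suc.IH)
qed simp

lemma Ck_on_GDERIV: "Ck_on (Suc k) UNIV f \<Longrightarrow> GDERIV f x :> gradient f x"
  by (rule GDERIV_gradient) simp

lemma Ck_on_const [simp]: "Ck_on k UNIV (\<lambda>x::'a::euclidean_space. c)"
proof (induction k arbitrary: c)
  case (Suc k)
  show ?case
    by (rule Ck_on_Suc_UNIV_I[where g="\<lambda>_. 0"]) (auto intro: GDERIV_const Suc)
qed auto

lemma Ck_on_inner_left: "Ck_on k UNIV (\<lambda>x::'a::euclidean_space. x \<bullet> v)"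
proof (cases k)
  case (Suc j)
  have "GDERIV (\<lambda>x. x \<bullet> v) x :> v" for x
    unfolding gderiv_def by (intro bounded_linear_imp_has_derivative bounded_linear_inner_left)
  then show ?thesis
    unfolding Suc by (intro Ck_on_Suc_UNIV_I[where g="\<lambda>_. v"]) auto
qed (simp add: continuous_on_inner continuous_on_id continuous_on_const)

lemma Ck_on_add:
  "Ck_on k UNIV f \<Longrightarrow> Ck_on k UNIV g \<Longrightarrow> Ck_on k UNIV (\<lambda>x. f x + g x)"
proof (induction k arbitrary: f g)
  case (Suc k)
  show ?case
    using Suc.prems
    by (intro Ck_on_Suc_UNIV_I[where g="\<lambda>x. gradient f x + gradient g x"] GDERIV_add)
      (auto simp: inner_add_left intro!: Suc.IH GDERIV_gradient)
qed (simp add: continuous_on_add)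

lemma Ck_on_mult:
  "Ck_on k UNIV f \<Longrightarrow> Ck_on k UNIV g \<Longrightarrow> Ck_on k UNIV (\<lambda>x. f x * g x)"
proof (induction k arbitrary: f g)
  case (Suc k)
  have "Ck_on k UNIV f" "Ck_on k UNIV g"
    using Suc.prems by - (rule Ck_on_SucD, assumption)+
  then show ?case
    using Suc.prems
    by (intro Ck_on_Suc_UNIV_I[where g="\<lambda>x. f x *\<^sub>R gradient g x + g x *\<^sub>R gradient f x"] GDERIV_mult)
      (auto simp: inner_add_left intro!: Suc.IH GDERIV_gradient Ck_on_add)
qed (simp add: continuous_on_mult)

lemma Ck_on_sum:
  "(\<And>i. i \<in> I \<Longrightarrow> Ck_on k UNIV (f i)) \<Longrightarrow> Ck_on k UNIV (\<lambda>x. \<Sum>i\<in>I. f i x)"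
  by (induction I rule: infinite_finite_induct) (simp_all add: Ck_on_add)

text \<open>The outer function enters as the whole sequence of its derivatives \<open>h j\<close>,
  so that the chain rule leads from \<open>h j\<close> to \<open>h (Suc j)\<close> and the induction
  hypothesis applies with \<open>j\<close> free.\<close>

lemma Ck_on_compose:
  assumes h: "\<And>j t. (h j has_real_derivative h (Suc j) t) (at t)"
  shows "Ck_on k UNIV g \<Longrightarrow> Ck_on k UNIV (\<lambda>x. h j (g x))"
proof (induction k arbitrary: j g)
  case 0
  have "continuous_on UNIV (h j)"
    using h by (meson DERIV_isCont continuous_at_imp_continuous_on)
  then show ?case
    using 0 by (auto intro: continuous_on_compose2)
next
  case (Suc k)
  have g: "Ck_on k UNIV g"
    using Suc.prems by (rule Ck_on_SucD)
  show ?case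
  proof (rule Ck_on_Suc_UNIV_I)
    show "GDERIV (\<lambda>x. h j (g x)) x :> h (Suc j) (g x) *\<^sub>R gradient g x" for x
      using Ck_on_GDERIV[OF Suc.prems] h by (rule GDERIV_DERIV_compose)
    show "Ck_on k UNIV (\<lambda>x. (h (Suc j) (g x) *\<^sub>R gradient g x) \<bullet> b)" if "b \<in> Basis" for b
      using Suc.prems that by (simp add: Ck_on_mult Suc.IH[OF g])
  qed
qed

lemma Ck_on_norm_sq: "Ck_on k UNIV (\<lambda>x::'a::euclidean_space. x \<bullet> x)"
proof -
  have "Ck_on k UNIV (\<lambda>x::'a. \<Sum>b\<in>Basis. (x \<bullet> b) * (x \<bullet> b))"
    by (intro Ck_on_sum Ck_on_mult Ck_on_inner_left)
  then show ?thesis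
    by (subst euclidean_inner)
qed

text \<open>The functions \<open>flat P\<close> are closed under differentiation and contain \<open>exp(-1/t)\<close>, so its
  smoothness can be proved by an induction that stays inside this class.\<close>

definition flat :: "real poly \<Rightarrow> real \<Rightarrow> real" where
  "flat P t = (if t > 0 then poly P (1 / t) * exp (- (1 / t)) else 0)"

lemma tendsto_poly_times_exp_minus: "((\<lambda>x::real. poly P x * exp (- x)) \<longlongrightarrow> 0) at_top"
proof -
  have "((\<lambda>x::real. \<Sum>i\<le>degree P. coeff P i * (x ^ i / exp x)) \<longlongrightarrow> (\<Sum>i\<le>degree P. coeff P i * 0)) at_top"
    by (intro tendsto_sum tendsto_mult tendsto_const tendsto_power_div_exp_0)
  then show ?thesis
    by (simp add: poly_altdef exp_minus divide_inverse sum_distrib_right mult.assoc)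
qed

lemma flat_tendsto_0: "(flat P \<longlongrightarrow> 0) (at_right 0)"
proof -
  have "((\<lambda>t. poly P (inverse t) * exp (- inverse t)) \<longlongrightarrow> 0) (at_right 0)"
    using filterlim_compose[OF tendsto_poly_times_exp_minus filterlim_inverse_at_top_right] .
  then show ?thesis
    by (rule Lim_transform_eventually)
      (auto simp: flat_def eventually_at_right_less divide_inverse intro: eventually_mono[OF eventually_at_right_less])
qed

text \<open>For t > 0, differentiating P(1/t) exp(-1/t) gives (1/t^2) (P - P')(1/t) exp(-1/t), and
  \<open>[:0, 0, 1:]\<close> is X^2. The only delicate point is t = 0.\<close>

lemma DERIV_flat: "(flat P has_real_derivative flat ([:0, 0, 1:] * (P - pderiv P)) t) (at t)"
proof -
  consider "t > 0" | "t < 0" | "t = 0" by linarith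
  then show ?thesis
  proof cases
    case 1
    have "((\<lambda>t. poly P (1 / t) * exp (- (1 / t))) has_real_derivative
        flat ([:0, 0, 1:] * (P - pderiv P)) t) (at t)"
      using 1 by (auto intro!: derivative_eq_intros poly_DERIV[THEN DERIV_chain2]
          simp: flat_def field_simps power2_eq_square)
    then show ?thesis
      using 1 by (rule_tac has_field_derivative_transform_within_open[where S="{0<..}"])
        (auto simp: flat_def)
  next
    case 2
    have "((\<lambda>t. 0) has_real_derivative flat ([:0, 0, 1:] * (P - pderiv P)) t) (at t)"
      using 2 by (auto simp: flat_def)
    then show ?thesis
      using 2 by (rule_tac has_field_derivative_transform_within_open[where S="{..<0}"])
        (auto simp: flat_def)
  next
    case 3
    \<comment> \<open>For h > 0 the difference quotient at 0 is again a flat function: dividing by h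
      multiplies the polynomial by X, which is \<open>pCons 0 P\<close>.\<close>
    have "((\<lambda>h. flat P h / h) \<longlongrightarrow> 0) (at_right 0)"
      using flat_tendsto_0[of "pCons 0 P"]
      by (rule Lim_transform_eventually)
        (auto simp: flat_def intro!: eventually_mono[OF eventually_at_right_less])
    moreover have "((\<lambda>h. flat P h / h) \<longlongrightarrow> 0) (at_left 0)"
      by (rule tendsto_eventually)
        (auto simp: flat_def eventually_at_filter intro!: always_eventually)
    ultimately have "((\<lambda>h. flat P h / h) \<longlongrightarrow> 0) (at 0)"
      by (simp add: filterlim_split_at)
    then show ?thesis
      by (simp add: DERIV_def 3) (simp add: flat_def)
  qed
qed

definition smooth_step :: "real \<Rightarrow> real" where
  "smooth_step t = (if t > 0 then exp (- (1 / t)) else 0)"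

definition smooth_step_deriv :: "real \<Rightarrow> real" where
  "smooth_step_deriv t = (if t > 0 then exp (- (1 / t)) / t\<^sup>2 else 0)"

lemma smooth_step_eq_flat: "smooth_step = flat 1"
  by (auto simp: smooth_step_def flat_def)

lemma DERIV_smooth_step: "(smooth_step has_real_derivative smooth_step_deriv t) (at t)"
proof -
  have "flat ([:0, 0, 1:] * (1 - pderiv 1)) t = smooth_step_deriv t"
    by (simp add: flat_def smooth_step_deriv_def power2_eq_square)
  then show ?thesis
    using DERIV_flat[of 1 t] by (simp add: smooth_step_eq_flat)
qed

lemma continuous_on_smooth_step: "continuous_on S smooth_step"
  by (rule DERIV_continuous_on[OF has_field_derivative_at_within[OF DERIV_smooth_step]])

lemma continuous_on_smooth_step_deriv: "continuous_on S smooth_step_deriv"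
proof -
  have "smooth_step_deriv = flat [:0, 0, 1:]"
    by (auto simp: flat_def smooth_step_deriv_def power2_eq_square)
  then show ?thesis
    using DERIV_continuous_on[OF has_field_derivative_at_within[OF DERIV_flat[of "[:0, 0, 1:]"]]]
      by simp
qed

lemma Ck_on_smooth_step:
  assumes "Ck_on k UNIV g"
  shows "Ck_on k UNIV (\<lambda>x. smooth_step (g x))"
proof -
  \<comment> \<open>\<open>Q j\<close> is the polynomial belonging to the \<open>j\<close>-th
    derivative of exp(-1/t).\<close>
  define Q where "Q j = ((\<lambda>P::real poly. [:0, 0, 1:] * (P - pderiv P)) ^^ j) 1" for j
  have "(flat (Q j) has_real_derivative flat (Q (Suc j)) t) (at t)" for j t
    using DERIV_flat[of "Q j" t] by (simp only: Q_def funpow.simps o_apply)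
  then have "Ck_on k UNIV (\<lambda>x. flat (Q 0) (g x))"
    using assms by (rule Ck_on_compose[where h="\<lambda>j. flat (Q j)"])
  then show ?thesis
    by (simp add: smooth_step_eq_flat Q_def)
qed

lemma smooth_step_nonneg [simp]: "0 \<le> smooth_step t"
  by (simp add: smooth_step_def)

lemma smooth_step_le_1 [simp]: "smooth_step t \<le> 1"
  by (simp add: smooth_step_def)

lemma smooth_step_mono: "s \<le> t \<Longrightarrow> smooth_step s \<le> smooth_step t"
  by (auto simp: smooth_step_def frac_le)

lemma smooth_step_pos_iff [simp]: "0 < smooth_step t \<longleftrightarrow> 0 < t"
  by (simp add: smooth_step_def)

lemma smooth_step_deriv_nonneg [simp]: "0 \<le> smooth_step_deriv t"
  by (simp add: smooth_step_deriv_def)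

text \<open>Splitting exp(-1/t) = exp(-1/(p t)) exp(-(p-1)/(p t)) spends only the first factor on
  the pole 1/t^2. The same shape of bound holds for a p-th power: the derivative of v^p is a
  multiple of (v^p)^((p-1)/p).\<close>

lemma smooth_step_deriv_le:
  assumes "1 < p"
  shows "smooth_step_deriv t \<le> 2 * p\<^sup>2 * smooth_step t powr ((p - 1) / p)"
proof (cases "t > 0")
  case True
  \<comment> \<open>With this \<open>y\<close>, 1/t^2 = p^2 y^2, so that y^2 exp(-y) \<le> 2 yields
    the constant 2 p^2.\<close>
  define y where "y = 1 / (p * t)"
  have "y > 0" using True assms by (simp add: y_def)
  then have "y\<^sup>2 / 2 \<le> exp y"
    using exp_lower_Taylor_quadratic[of y] by simp
  then have *: "y\<^sup>2 * exp (- y) \<le> 2"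
    by (simp add: exp_minus field_simps)
  have "smooth_step_deriv t = p\<^sup>2 * (y\<^sup>2 * exp (- y)) * exp (- (1 / t) * ((p - 1) / p))"
  proof -
    have "- (1 / t) = - (1 / (p * t)) + - (1 / t) * ((p - 1) / p)"
      using True assms by (simp add: field_simps)
    then have "exp (- (1 / t)) = exp (- (1 / (p * t))) * exp (- (1 / t) * ((p - 1) / p))"
      by (metis exp_add)
    then show ?thesis
      using True assms by (simp add: smooth_step_deriv_def y_def power2_eq_square)
  qed
  also have "\<dots> \<le> p\<^sup>2 * 2 * exp (- (1 / t) * ((p - 1) / p))"
    using * by (intro mult_mono) auto
  also have "exp (- (1 / t) * ((p - 1) / p)) = smooth_step t powr ((p - 1) / p)"
    using True by (simp add: smooth_step_def powr_def)
  finally show ?thesis by simp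
qed (simp add: smooth_step_deriv_def)

text \<open>The case p = 2 of the preceding estimate, where 2 * 2^2 = 8. A bound independent of
  \<open>t\<close> is what the limit along mollifications of \<open>u\<close> requires.\<close>

lemma smooth_step_deriv_le_8: "smooth_step_deriv t \<le> 8"
proof -
  have "smooth_step t powr (1 / 2) \<le> 1"
    by (rule powr_le1) auto
  moreover have "smooth_step_deriv t \<le> 8 * smooth_step t powr (1 / 2)"
    using smooth_step_deriv_le[of 2 t] by simp
  ultimately show ?thesis
    by linarith
qed

section \<open>Test functions and their gradients\<close>

lemma test_function_iff:
  "test_function \<phi> \<longleftrightarrow> (\<forall>k. Ck_on k UNIV \<phi>) \<and> (\<exists>S. \<forall>x. norm x > S \<longrightarrow> \<phi> x = 0)"
proof -
  have "compact (closure {x. \<phi> x \<noteq> 0}) \<longleftrightarrow> (\<exists>S. \<forall>x. norm x > S \<longrightarrow> \<phi> x = 0)"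
    by (simp add: compact_closure bounded_iff) (meson not_le)
  then show ?thesis by (simp add: test_function_def)
qed

lemma test_function_Ck: "test_function \<phi> \<Longrightarrow> Ck_on k UNIV \<phi>"
  by (simp add: test_function_def)

lemma test_function_GDERIV: "test_function \<phi> \<Longrightarrow> GDERIV \<phi> x :> gradient \<phi> x"
  by (rule Ck_on_GDERIV[OF test_function_Ck])

lemma test_function_continuous: "test_function \<phi> \<Longrightarrow> continuous_on UNIV \<phi>"
  by (rule Ck_on_imp_continuous[OF test_function_Ck])

lemma gradient_eq_0_outside:
  fixes \<phi> :: "'a::euclidean_space \<Rightarrow> real"
  assumes "\<And>x. norm x > S \<Longrightarrow> \<phi> x = 0" and "norm x > S"
  shows "gradient \<phi> x = 0"
proof (rule gradient_eqI)
  have "open {x::'a. norm x > S}"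
    by (intro open_Collect_less continuous_intros)
  then show "GDERIV \<phi> x :> 0"
    unfolding gderiv_def using assms
    by (rule_tac has_derivative_transform_within_open[where f="\<lambda>_. 0" and s="{x. norm x > S}"])
      simp_all
qed

lemma test_function_gradient:
  assumes "test_function \<phi>" "b \<in> Basis"
  shows "test_function (\<lambda>x. gradient \<phi> x \<bullet> b)"
proof -
  have "Ck_on (Suc k) UNIV \<phi>" for k
    using assms(1) by (rule test_function_Ck)
  moreover obtain S where "\<And>x. norm x > S \<Longrightarrow> \<phi> x = 0"
    using assms(1) by (auto simp: test_function_iff)
  then have "\<And>x. norm x > S \<Longrightarrow> gradient \<phi> x = 0"
    by (rule gradient_eq_0_outside)
  then have "\<exists>S. \<forall>x. norm x > S \<longrightarrow> gradient \<phi> x \<bullet> b = 0"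
    by (metis inner_zero_left)
  ultimately show ?thesis
    using assms(2) by (auto simp: test_function_iff)
qed

lemma test_function_gradient_continuous:
  assumes "test_function \<phi>"
  shows "continuous_on UNIV (gradient \<phi>)"
proof -
  have "continuous_on UNIV (\<lambda>x. \<Sum>b\<in>Basis. (gradient \<phi> x \<bullet> b) *\<^sub>R b)"
    by (intro continuous_intros test_function_continuous test_function_gradient assms)
  then show ?thesis
    by (simp add: euclidean_representation)
qed

section \<open>Mollification\<close>

lemma integrable_continuous_vanishing:
  fixes f :: "'a::euclidean_space \<Rightarrow> 'b::euclidean_space"
  assumes "continuous_on UNIV f" and "\<And>x. norm x > S \<Longrightarrow> f x = 0"
  shows "integrable lborel f"
proof -
  have "integrable lborel (\<lambda>x. indicator (cball 0 S) x *\<^sub>R f x)"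
    using continuous_on_subset[OF assms(1) subset_UNIV] by (intro borel_integrable_compact) auto
  moreover have "(\<lambda>x. indicator (cball 0 S) x *\<^sub>R f x) = f"
    using assms(2) by (force simp: indicator_def not_le)
  ultimately show ?thesis by simp
qed

lemma uniformly_continuous_vanishing:
  fixes f :: "'a::euclidean_space \<Rightarrow> 'b::euclidean_space"
  assumes "continuous_on UNIV f" and S: "\<And>x. norm x > S \<Longrightarrow> f x = 0"
  shows "uniformly_continuous_on UNIV f"
  unfolding uniformly_continuous_on_def
proof (intro allI impI)
  fix e :: real assume "e > 0"
  \<comment> \<open>The margin 1 matters: two points closer than 1 lie either both in this ball or
    both outside the ball of radius \<open>S\<close>, where \<open>f\<close> vanishes.\<close>
  have "uniformly_continuous_on (cball 0 (S + 1)) f"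
    using continuous_on_subset[OF assms(1) subset_UNIV] by (intro compact_uniformly_continuous) auto
  then obtain d where "d > 0"
    and d: "\<And>x y. norm x \<le> S + 1 \<Longrightarrow> norm y \<le> S + 1 \<Longrightarrow> dist y x < d \<Longrightarrow> dist (f y) (f x) < e"
    unfolding uniformly_continuous_on_def using \<open>e > 0\<close> by force
  have "dist (f y) (f x) < e" if "dist y x < min d 1" for x y
  proof (cases "norm x \<le> S + 1 \<and> norm y \<le> S + 1")
    case True
    then show ?thesis using d that by auto
  next
    case False
    have "\<bar>norm y - norm x\<bar> < 1"
      using that norm_triangle_ineq3[of y x] by (simp add: dist_norm)
    then have "norm x > S" "norm y > S"
      using False by linarith+
    then show ?thesis using S \<open>e > 0\<close> by simp
  qed
  then show "\<exists>d>0. \<forall>x\<in>UNIV. \<forall>y\<in>UNIV. dist y x < d \<longrightarrow> dist (f y) (f x) < e"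
    using \<open>d > 0\<close> by (intro exI[of _ "min d 1"]) auto
qed

lemma bounded_continuous_vanishing:
  fixes f :: "'a::euclidean_space \<Rightarrow> 'b::euclidean_space"
  assumes "continuous_on UNIV f" and S: "\<And>x. norm x > S \<Longrightarrow> f x = 0"
  obtains M where "M \<ge> 0" "\<And>x. norm (f x) \<le> M"
proof -
  have "compact (f ` cball 0 S)"
    using continuous_on_subset[OF assms(1) subset_UNIV] by (intro compact_continuous_image) auto
  then obtain M where "\<forall>y \<in> f ` cball 0 S. norm y \<le> M"
    using compact_imp_bounded bounded_iff by metis
  then have M: "norm (f x) \<le> M" if "norm x \<le> S" for x
    using that by simp
  have "norm (f x) \<le> max M 0" for x
    using M[of x] S[of x] by (cases "norm x \<le> S") auto
  then show ?thesis
    using that[of "max M 0"] by auto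
qed

lemma test_function_vanishing:
  assumes "test_function \<phi>"
  obtains S where "S \<ge> 0" "\<And>x. norm x > S \<Longrightarrow> \<phi> x = 0"
proof -
  obtain S where "\<And>x. norm x > S \<Longrightarrow> \<phi> x = 0"
    using assms by (auto simp: test_function_iff)
  then show ?thesis
    using that[of "max S 0"] by auto
qed

text \<open>The expansion is uniform in \<open>z\<close>, because the gradient is uniformly
  continuous and the mean value theorem holds on each segment; this permits differentiation under
  the integral below. The bound \<open>d \<le> 1\<close> keeps the supports of nearby translates
  under control.\<close>

lemma test_function_first_order:
  assumes "test_function \<psi>" "e > 0"
  obtains d where "d > 0" "d \<le> 1"
    "\<And>z h. norm h < d \<Longrightarrow> \<bar>\<psi> (z + h) - \<psi> z - h \<bullet> gradient \<psi> z\<bar> \<le> e * norm h"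
proof -
  obtain S where "\<And>x. norm x > S \<Longrightarrow> \<psi> x = 0"
    using assms(1) by (rule test_function_vanishing) blast
  then have "uniformly_continuous_on UNIV (gradient \<psi>)"
    by (intro uniformly_continuous_vanishing[of _ S] test_function_gradient_continuous assms(1))
      (rule gradient_eq_0_outside)
  then obtain d where "d > 0" and d: "\<And>x y. dist y x < d \<Longrightarrow> dist (gradient \<psi> y) (gradient \<psi> x) < e"
    unfolding uniformly_continuous_on_def using \<open>e > 0\<close> by auto
  have "\<bar>\<psi> (z + h) - \<psi> z - h \<bullet> gradient \<psi> z\<bar> \<le> e * norm h" if h: "norm h < min d 1" for z h
  proof -
    have deriv: "((\<lambda>t. \<psi> (z + t *\<^sub>R h)) has_real_derivative h \<bullet> gradient \<psi> (z + t *\<^sub>R h)) (at t)"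
        for t :: real
    proof -
      have "(\<psi> has_derivative (\<lambda>v. v \<bullet> gradient \<psi> (z + t *\<^sub>R h))) (at (z + t *\<^sub>R h))"
        using test_function_GDERIV[OF assms(1)] by (simp add: gderiv_def)
      moreover have "((\<lambda>t. z + t *\<^sub>R h) has_derivative (\<lambda>s. s *\<^sub>R h)) (at t)"
        by (auto intro!: derivative_eq_intros)
      ultimately have "((\<lambda>t. \<psi> (z + t *\<^sub>R h)) has_derivative (\<lambda>s. (s *\<^sub>R h) \<bullet> gradient \<psi> (z
          + t *\<^sub>R h))) (at t)"
        by (rule has_derivative_compose[rotated])
      then show ?thesis
        by (simp add: has_field_derivative_def mult.commute[of _ "h \<bullet> _"])
    qed
    obtain t where t: "0 < t" "t < 1"
      "\<psi> (z + 1 *\<^sub>R h) - \<psi> (z + 0 *\<^sub>R h) = (1 - 0) * (h \<bullet> gradient \<psi> (z + t *\<^sub>R h))"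
      using MVT2[OF zero_less_one deriv] by blast
    have "dist (z + t *\<^sub>R h) z < d"
      using t h mult_left_le_one_le[of "norm h" t] by (simp add: dist_norm)
    then have "norm (gradient \<psi> (z + t *\<^sub>R h) - gradient \<psi> z) \<le> e"
      using d by (simp add: dist_norm less_imp_le)
    moreover have "\<psi> (z + h) - \<psi> z - h \<bullet> gradient \<psi> z = h \<bullet> (gradient \<psi> (z + t *\<^sub>R h) - gradient \<psi> z)"
      using t by (simp add: inner_diff_right)
    ultimately show ?thesis
      using Cauchy_Schwarz_ineq2[of h "gradient \<psi> (z + t *\<^sub>R h) - gradient \<psi> z"]
        mult_left_mono[of "norm (gradient \<psi> (z + t *\<^sub>R h) - gradient \<psi> z)" e "norm h"]
      by (simp add: mult.commute)
  qed
  then show ?thesis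
    using that[of "min d 1"] \<open>d > 0\<close> by auto
qed

section \<open>Convolution with a test function\<close>

lemma integrable_convolution_test:
  fixes u :: "'a::euclidean_space \<Rightarrow> real" and \<psi> :: "'a \<Rightarrow> 'b::euclidean_space"
  assumes u: "continuous_on UNIV u" and \<psi>: "continuous_on UNIV \<psi>" and S: "\<And>x. norm x > S \<Longrightarrow> \<psi> x = 0"
  shows "integrable lborel (\<lambda>y. u y *\<^sub>R \<psi> (x - y))"
proof (rule integrable_continuous_vanishing[of _ "S + norm x"])
  show "continuous_on UNIV (\<lambda>y. u y *\<^sub>R \<psi> (x - y))"
    by (intro continuous_intros u continuous_on_compose2[OF \<psi>]) auto
  show "u y *\<^sub>R \<psi> (x - y) = 0" if "norm y > S + norm x" for y
    using that norm_triangle_ineq2[of y x] S[of "x - y"] by (simp add: norm_minus_commute)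
qed

text \<open>The uniform first-order expansion of \<open>\<psi>\<close> is integrated against
  \<open>u\<close>. As increments are shorter than 1, the remainder lives in the ball of radius
  \<open>S + 1\<close> about \<open>x\<close>, on which the continuous \<open>u\<close> has a finite
  integral \<open>C\<close> of its absolute value.\<close>

lemma GDERIV_convolution:
  fixes u :: "'a::euclidean_space \<Rightarrow> real"
  assumes u: "continuous_on UNIV u" and \<psi>: "test_function \<psi>"
  shows "GDERIV (\<lambda>x. \<integral>y. u y * \<psi> (x - y) \<partial>lborel) x :> (\<integral>y. u y *\<^sub>R gradient \<psi> (x - y) \<partial>lborel)"
    (is "GDERIV ?F x :> ?D")
  unfolding gderiv_def has_derivative_at_alt
proof (intro conjI allI impI)
  show "bounded_linear (\<lambda>h. h \<bullet> ?D)"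
    by (rule bounded_linear_inner_left)
  fix e :: real assume "e > 0"
  obtain S where "S \<ge> 0" and S: "\<And>x. norm x > S \<Longrightarrow> \<psi> x = 0"
    using \<psi> by (rule test_function_vanishing) blast
  note grad0 = gradient_eq_0_outside[where \<phi>=\<psi>, OF S]
  have int: "integrable lborel (\<lambda>y. u y * \<psi> (x - y))" for x
    using integrable_convolution_test[OF u test_function_continuous[OF \<psi>] S] by simp
  have intg: "integrable lborel (\<lambda>y. u y *\<^sub>R gradient \<psi> (x - y))" for x
    using integrable_convolution_test[OF u test_function_gradient_continuous[OF \<psi>] grad0] by simp
  let ?I = "\<lambda>y. indicator (cball x (S + 1)) y *\<^sub>R \<bar>u y\<bar>"
  define C where "C = integral\<^sup>L lborel ?I"
  have intI: "integrable lborel ?I"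
    by (intro borel_integrable_compact continuous_intros continuous_on_subset[OF u]) auto
  have "C \<ge> 0"
    unfolding C_def by (intro integral_nonneg_AE) auto
  \<comment> \<open>Divided by \<open>C + 1\<close> and not by \<open>C\<close>, since
    \<open>C\<close> may be 0.\<close>
  define e' where "e' = e / (C + 1)"
  have "e' > 0" using \<open>e > 0\<close> \<open>C \<ge> 0\<close> by (simp add: e'_def)
  then obtain d where "d > 0" "d \<le> 1"
    and d: "\<And>z h. norm h < d \<Longrightarrow> \<bar>\<psi> (z + h) - \<psi> z - h \<bullet> gradient \<psi> z\<bar> \<le> e' * norm h"
    by (rule test_function_first_order[OF \<psi>]) (assumption | rule that)+
  have "\<bar>?F x' - ?F x - (x' - x) \<bullet> ?D\<bar> \<le> e * norm (x' - x)" if x': "norm (x' - x) < d" for x'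
  proof -
    let ?R = "\<lambda>y. u y * (\<psi> (x' - y) - \<psi> (x - y) - (x' - x) \<bullet> gradient \<psi> (x - y))"
    have eqR: "(\<lambda>y. u y * \<psi> (x' - y) - u y * \<psi> (x - y)
        - (x' - x) \<bullet> (u y *\<^sub>R gradient \<psi> (x - y))) = ?R"
      by (simp add: algebra_simps)
    have "?F x' - ?F x - (x' - x) \<bullet> ?D = (\<integral>y. u y * \<psi> (x' - y) - u y * \<psi> (x - y)
        - (x' - x) \<bullet> (u y *\<^sub>R gradient \<psi> (x - y)) \<partial>lborel)"
      by (simp only: Bochner_Integration.integral_diff int integrable_inner_right intg
          Bochner_Integration.integrable_diff integral_inner_right)
    also have "\<dots> = integral\<^sup>L lborel ?R"
      by (simp only: eqR)
    finally have eq: "?F x' - ?F x - (x' - x) \<bullet> ?D = integral\<^sup>L lborel ?R" .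
    have intR: "integrable lborel ?R"
      unfolding eqR[symmetric]
      by (intro Bochner_Integration.integrable_diff int integrable_inner_right intg)
    have bound: "norm (?R y) \<le> e' * norm (x' - x) * ?I y" for y
    proof (cases "y \<in> cball x (S + 1)")
      case True
      have le: "\<bar>\<psi> (x' - y) - \<psi> (x - y) - (x' - x) \<bullet> gradient \<psi> (x - y)\<bar> \<le> e' * norm (x' - x)"
        using d[OF x', of "x - y"] by (simp add: algebra_simps)
      then show ?thesis
        using True mult_right_mono[OF le, of "\<bar>u y\<bar>"] by (simp add: abs_mult mult.commute)
    next
      case False
      then have "norm (x - y) > S + 1"
        by (simp add: dist_norm)
      moreover have "norm (x - y) \<le> norm (x' - y) + norm (x' - x)"
        by norm
      ultimately have "norm (x - y) > S" "norm (x' - y) > S"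
        using x' \<open>d \<le> 1\<close> by linarith+
      then show ?thesis
        using False S grad0 by simp
    qed
    have "norm (integral\<^sup>L lborel ?R) \<le> (\<integral>y. e' * norm (x' - x) * ?I y \<partial>lborel)"
      by (rule order_trans[OF Bochner_Integration.integral_norm_bound integral_mono[OF
              integrable_norm[OF intR] integrable_mult_right[OF intI] bound]])
    also have "\<dots> = e' * norm (x' - x) * C"
      by (simp add: C_def)
    also have "\<dots> = e * norm (x' - x) * (C / (C + 1))"
      by (simp add: e'_def)
    also have "\<dots> \<le> e * norm (x' - x) * 1"
      using \<open>e > 0\<close> \<open>C \<ge> 0\<close> by (intro mult_left_mono) auto
    finally show ?thesis
      using eq by simp
  qed
  then show "\<exists>d>0. \<forall>y. norm (y - x) < d \<longrightarrow> norm (?F y - ?F x - (y - x) \<bullet> ?D) \<le> e * norm (y - x)"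
    using \<open>d > 0\<close> by auto
qed

text \<open>Every derivative falls on \<open>\<psi>\<close>, and a partial derivative of the
  convolution is the convolution with a partial derivative of \<open>\<psi>\<close>, again a test
  function; so the induction runs over all \<open>\<psi>\<close> at once.\<close>

lemma Ck_on_convolution:
  fixes u :: "'a::euclidean_space \<Rightarrow> real"
  assumes u: "continuous_on UNIV u"
  shows "test_function \<psi> \<Longrightarrow> Ck_on k UNIV (\<lambda>x. \<integral>y. u y * \<psi> (x - y) \<partial>lborel)"
proof (induction k arbitrary: \<psi>)
  case 0
  have "(\<lambda>x. \<integral>y. u y * \<psi> (x - y) \<partial>lborel) differentiable (at x)" for x
    using GDERIV_convolution[OF u 0] by (rule GDERIV_imp_differentiable)
  then show ?case
    by (auto intro!: differentiable_imp_continuous_on simp: differentiable_on_def)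
next
  case (Suc k)
  show ?case
  proof (rule Ck_on_Suc_UNIV_I[OF GDERIV_convolution[OF u Suc.prems]])
    fix b :: 'a assume b: "b \<in> Basis"
    obtain S where S: "\<And>x. norm x > S \<Longrightarrow> \<psi> x = 0"
      using Suc.prems by (rule test_function_vanishing) blast
    have "integrable lborel (\<lambda>y. u y *\<^sub>R gradient \<psi> (x - y))" for x
      using integrable_convolution_test[OF u test_function_gradient_continuous[OF Suc.prems]
          gradient_eq_0_outside[where \<phi>=\<psi>, OF S]] by simp
    then have "(\<integral>y. u y *\<^sub>R gradient \<psi> (x - y) \<partial>lborel) \<bullet> b
        = (\<integral>y. u y * (gradient \<psi> (x - y) \<bullet> b) \<partial>lborel)" for x
      by (subst integral_inner_left[symmetric]) auto
    then show "Ck_on k UNIV (\<lambda>x. (\<integral>y. u y *\<^sub>R gradient \<psi> (x - y) \<partial>lborel) \<bullet> b)"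
      using Suc.IH[OF test_function_gradient[OF Suc.prems b]] by simp
  qed
qed

lemma GDERIV_reflect:
  assumes "test_function \<psi>"
  shows "GDERIV (\<lambda>y. \<psi> (x - y)) y :> - gradient \<psi> (x - y)"
proof -
  have "(\<psi> has_derivative (\<lambda>v. v \<bullet> gradient \<psi> (x - y))) (at (x - y))"
    using test_function_GDERIV[OF assms] by (simp add: gderiv_def)
  moreover have "((\<lambda>y. x - y) has_derivative (\<lambda>v. - v)) (at y)"
    by (auto intro!: derivative_eq_intros)
  ultimately have "((\<lambda>y. \<psi> (x - y)) has_derivative (\<lambda>v. (- v) \<bullet> gradient \<psi> (x - y))) (at y)"
    by (rule has_derivative_compose[rotated])
  then show ?thesis
    by (simp add: gderiv_def)
qed

text \<open>This is the function of \<open>y\<close> that is inserted into the definition of the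
  weak gradient to differentiate a convolution.\<close>

lemma test_function_reflect:
  assumes "test_function \<psi>"
  shows "test_function (\<lambda>y. \<psi> (x - y))"
proof -
  have "Ck_on k UNIV (\<lambda>y. \<psi> (x - y))" for k
    using assms
  proof (induction k arbitrary: \<psi>)
    case 0
    then show ?case
      by (simp add: continuous_on_compose2[OF test_function_continuous[OF 0]]
          continuous_on_diff continuous_on_const continuous_on_id)
  next
    case (Suc k)
    show ?case
    proof (rule Ck_on_Suc_UNIV_I[OF GDERIV_reflect[OF Suc.prems]])
      fix b :: 'a assume "b \<in> Basis"
      from Suc.IH[OF test_function_gradient[OF Suc.prems this]]
      have "Ck_on k UNIV (\<lambda>y. (- 1) * (gradient \<psi> (x - y) \<bullet> b))"
        by (rule Ck_on_mult[OF Ck_on_const])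
      then show "Ck_on k UNIV (\<lambda>y. - gradient \<psi> (x - y) \<bullet> b)"
        by simp
    qed
  qed
  moreover obtain S where S: "\<And>x. norm x > S \<Longrightarrow> \<psi> x = 0"
    using assms by (rule test_function_vanishing) blast
  have "\<psi> (x - y) = 0" if "norm y > S + norm x" for y
    using that norm_triangle_ineq2[of y x] by (intro S) (simp add: norm_minus_commute)
  ultimately show ?thesis
    by (auto simp: test_function_iff)
qed

lemma integrable_convolution_locally:
  fixes G :: "'a::euclidean_space \<Rightarrow> 'b::euclidean_space"
  assumes G: "\<And>S. set_integrable lborel (cball 0 S) G" and [measurable]: "G \<in> borel_measurable borel"
    and \<psi>: "continuous_on UNIV \<psi>" and S: "\<And>x. norm x > S \<Longrightarrow> \<psi> x = 0"
  shows "integrable lborel (\<lambda>y. \<psi> (x - y) *\<^sub>R G y)"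
proof -
  obtain M where M: "M \<ge> 0" "\<And>x. norm (\<psi> x :: real) \<le> M"
    by (rule bounded_continuous_vanishing[OF \<psi> S]) (assumption | rule that)+
  have [measurable]: "\<psi> \<in> borel_measurable borel"
    using \<psi> by (rule borel_measurable_continuous_onI)
  show ?thesis
  proof (rule Bochner_Integration.integrable_bound)
    show "integrable lborel (\<lambda>y. M * norm (indicator (cball 0 (S + norm x)) y *\<^sub>R G y))"
      using G[of "S + norm x"] by (simp add: set_integrable_def integrable_norm del: norm_scaleR)
    show "AE y in lborel. norm (\<psi> (x - y) *\<^sub>R G y)
        \<le> norm (M * norm (indicator (cball 0 (S + norm x)) y *\<^sub>R G y))"
    proof (intro always_eventually allI)
      fix y
      show "norm (\<psi> (x - y) *\<^sub>R G y) \<le> norm (M * norm (indicator (cball 0 (S + norm x)) y *\<^sub>R G y))"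
      proof (cases "norm y \<le> S + norm x")
        case True
        then show ?thesis
          using M by (simp add: mult_right_mono)
      next
        case False
        then have "\<psi> (x - y) = 0"
          using norm_triangle_ineq2[of y x] by (intro S) (simp add: norm_minus_commute)
        then show ?thesis by (simp add: M)
      qed
    qed
  qed measurable
qed

text \<open>The derivative moves from \<open>\<psi>\<close> to \<open>u\<close> through two sign
  changes that cancel: one from reflecting the argument of \<open>\<psi>\<close>, one from the weak
  integration by parts.\<close>

lemma gradient_convolution:
  fixes u :: "'a::euclidean_space \<Rightarrow> real"
  assumes u: "continuous_on UNIV u" and \<psi>: "test_function \<psi>"
    and G: "\<And>S. set_integrable lborel (cball 0 S) G" "G \<in> borel_measurable borel"
    and weak: "\<And>\<phi> b. test_function \<phi> \<Longrightarrow> b \<in> Basis \<Longrightarrow>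
      (\<integral>x. u x * (gradient \<phi> x \<bullet> b) \<partial>lborel) = - (\<integral>x. (G x \<bullet> b) * \<phi> x \<partial>lborel)"
  shows "gradient (\<lambda>x. \<integral>y. u y * \<psi> (x - y) \<partial>lborel) x = (\<integral>y. \<psi> (x - y) *\<^sub>R G y \<partial>lborel)"
proof -
  obtain S where S: "\<And>x. norm x > S \<Longrightarrow> \<psi> x = 0"
    using \<psi> by (rule test_function_vanishing) blast
  have int: "integrable lborel (\<lambda>y. u y *\<^sub>R gradient \<psi> (x - y))"
    using integrable_convolution_test[OF u test_function_gradient_continuous[OF \<psi>]
          gradient_eq_0_outside[where \<phi>=\<psi>, OF S]] by simp
  have int': "integrable lborel (\<lambda>y. \<psi> (x - y) *\<^sub>R G y)"
    by (rule integrable_convolution_locally[OF G test_function_continuous[OF \<psi>] S])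
  have "(\<integral>y. u y *\<^sub>R gradient \<psi> (x - y) \<partial>lborel) \<bullet> b = (\<integral>y. \<psi> (x - y) *\<^sub>R G y \<partial>lborel) \<bullet> b"
    if b: "b \<in> Basis" for b
  proof -
    have "(\<integral>y. u y *\<^sub>R gradient \<psi> (x - y) \<partial>lborel) \<bullet> b
        = (\<integral>y. u y * (gradient \<psi> (x - y) \<bullet> b) \<partial>lborel)"
      using int by (subst integral_inner_left[symmetric]) auto
    also have "\<dots> = - (\<integral>y. u y * (gradient (\<lambda>y. \<psi> (x - y)) y \<bullet> b) \<partial>lborel)"
      by (simp add: gradient_eqI[OF GDERIV_reflect[OF \<psi>]])
    also have "\<dots> = (\<integral>y. (G y \<bullet> b) * \<psi> (x - y) \<partial>lborel)"
      using weak[OF test_function_reflect[OF \<psi>] b] by simp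
    also have "\<dots> = (\<integral>y. \<psi> (x - y) *\<^sub>R G y \<partial>lborel) \<bullet> b"
      using int' by (subst integral_inner_left[symmetric]) (auto simp: mult.commute)
    finally show ?thesis .
  qed
  then show ?thesis
    unfolding gradient_eqI[OF GDERIV_convolution[OF u \<psi>]] by (rule euclidean_eqI)
qed

text \<open>A nonempty open set is not negligible. Used to see that a mollifier can be normalized
  and for the contradiction at the end.\<close>

lemma continuous_AE_eq_0_D:
  fixes f :: "'a::euclidean_space \<Rightarrow> real"
  assumes "continuous_on UNIV f" "AE x in lborel. f x = 0"
  shows "f x = 0"
proof (rule ccontr)
  assume "f x \<noteq> 0"
  have op: "open {x. f x \<noteq> 0}"
    using assms(1) by (intro open_Collect_neq continuous_on_const)
  from assms(2) have "{x. f x \<noteq> 0} \<in> null_sets lborel"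
    using op by (subst AE_iff_null_sets) (auto simp: borel_open)
  then have "negligible {x. f x \<noteq> 0}"
    by (simp add: negligible_iff_null_sets null_sets_completionI)
  then show False
    using open_not_negligible[OF op] \<open>f x \<noteq> 0\<close> by blast
qed

section \<open>Radial bumps and mollifiers\<close>

lemma radial_bump_vanishing:
  assumes "r > 0" "norm x \<ge> r"
  shows "smooth_step (1 - (norm x / r)\<^sup>2) = 0"
proof -
  have "norm x / r \<ge> 1"
    using assms by simp
  then have "(norm x / r)\<^sup>2 \<ge> 1"
    by (rule one_le_power)
  then show ?thesis by (simp add: smooth_step_def)
qed

text \<open>The square keeps the bump smooth at the origin, where the norm is not differentiable:
  the argument becomes the polynomial 1 - (x . x)/r^2.\<close>

lemma test_function_radial_bump:
  fixes r :: real
  assumes "r > 0"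
  shows "test_function (\<lambda>x::'a::euclidean_space. smooth_step (1 - (norm x / r)\<^sup>2))"
proof -
  have "(\<lambda>x::'a. smooth_step (1 - (norm x / r)\<^sup>2)) = (\<lambda>x. smooth_step (1 + (- (1 / r\<^sup>2)) * (x \<bullet> x)))"
    by (simp add: power_divide dot_square_norm)
  moreover have "Ck_on k UNIV (\<lambda>x::'a. smooth_step (1 + (- (1 / r\<^sup>2)) * (x \<bullet> x)))" for k
    by (rule Ck_on_smooth_step[OF Ck_on_add[OF Ck_on_const Ck_on_mult[OF Ck_on_const Ck_on_norm_sq]]])
  moreover have "\<forall>x::'a. norm x > r \<longrightarrow> smooth_step (1 - (norm x / r)\<^sup>2) = 0"
    by (intro allI impI radial_bump_vanishing assms) simp
  ultimately show ?thesis
    unfolding test_function_iff by metis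
qed

text \<open>Evenness makes \<open>\<rho> (x - y)\<close> a probability density in either variable;
  the density in \<open>x\<close> is the one that Fubini's theorem will need. As a predicate on all
  profiles concentrated at scale \<open>d\<close>, it lets several smallness requirements be met by
  shrinking \<open>d\<close>.\<close>

definition mollifier :: "real \<Rightarrow> ('a::euclidean_space \<Rightarrow> real) \<Rightarrow> bool" where
  "mollifier d \<rho> \<longleftrightarrow> test_function \<rho> \<and> (\<forall>x. 0 \<le> \<rho> x) \<and> (\<forall>x. \<rho> (- x) = \<rho> x) \<and>
     (\<forall>x. norm x \<ge> d \<longrightarrow> \<rho> x = 0) \<and> (\<integral>x. \<rho> x \<partial>lborel) = 1"

lemma mollifier_exists:
  assumes "d > 0"
  shows "\<exists>\<rho>::'a::euclidean_space \<Rightarrow> real. mollifier d \<rho>"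
proof -
  let ?b = "\<lambda>x::'a. smooth_step (1 - (norm x / d)\<^sup>2)"
  define c where "c = integral\<^sup>L lborel ?b"
  have b: "test_function ?b"
    using assms by (rule test_function_radial_bump)
  have vanish: "?b x = 0" if "norm x \<ge> d" for x
    using assms that by (rule radial_bump_vanishing)
  have int: "integrable lborel ?b"
    by (rule integrable_continuous_vanishing[OF test_function_continuous[OF b], of d]) (simp add: vanish)
  have "c \<noteq> 0"
  proof
    assume "c = 0"
    then have "AE x in lborel. ?b x = 0"
      using integral_nonneg_eq_0_iff_AE[OF int] by (simp add: c_def)
    then have "?b 0 = 0"
      by (rule continuous_AE_eq_0_D[OF test_function_continuous[OF b]])
    then show False
      by (simp add: smooth_step_def)
  qed
  moreover have "c \<ge> 0"
    unfolding c_def by simp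
  ultimately have "c > 0" by simp
  have "Ck_on k UNIV (\<lambda>x. (1 / c) * ?b x)" for k
    by (rule Ck_on_mult[OF Ck_on_const test_function_Ck[OF b]])
  moreover have "\<forall>x. norm x > d \<longrightarrow> (1 / c) * ?b x = 0"
    using vanish by simp
  ultimately have "test_function (\<lambda>x. (1 / c) * ?b x)"
    unfolding test_function_iff by blast
  moreover have "(\<integral>x. (1 / c) * ?b x \<partial>lborel) = 1"
    using \<open>c > 0\<close> int by (simp add: c_def)
  ultimately have "mollifier d (\<lambda>x. (1 / c) * ?b x)"
    using \<open>c > 0\<close> vanish by (simp add: mollifier_def)
  then show ?thesis by blast
qed

lemma nn_integral_mollifier:
  assumes "mollifier d \<rho>"
  shows "(\<integral>\<^sup>+y. ennreal (\<rho> (x - y)) \<partial>lborel) = 1" "(\<integral>\<^sup>+x. ennreal (\<rho> (x - y)) \<partial>lborel) = 1"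
proof -
  have cont: "continuous_on UNIV \<rho>"
    using assms by (simp add: mollifier_def test_function_continuous)
  then have [measurable]: "\<rho> \<in> borel_measurable borel"
    by (rule borel_measurable_continuous_onI)
  have even: "\<rho> (x - y) = \<rho> (y - x)" for x y
    using assms by (metis minus_diff_eq mollifier_def)
  have int: "integrable lborel \<rho>"
    by (rule integrable_continuous_vanishing[OF cont, of d]) (use assms in \<open>simp add: mollifier_def\<close>)
  have one: "(\<integral>\<^sup>+y. ennreal (\<rho> y) \<partial>lborel) = 1"
    using nn_integral_eq_integral[OF int] assms by (simp add: mollifier_def)
  have *: "(\<integral>\<^sup>+x. ennreal (\<rho> (x - y)) \<partial>lborel) = 1" for y
  proof -
    have "(\<integral>\<^sup>+y. ennreal (\<rho> y) \<partial>lborel) = (\<integral>\<^sup>+x. ennreal (\<rho> (- y + x)) \<partial>lborel)"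
      by (subst lborel_distr_plus[of "- y", symmetric], subst nn_integral_distr) auto
    then show ?thesis
      using one by simp
  qed
  show "(\<integral>\<^sup>+x. ennreal (\<rho> (x - y)) \<partial>lborel) = 1"
    by (rule *)
  show "(\<integral>\<^sup>+y. ennreal (\<rho> (x - y)) \<partial>lborel) = 1"
    using *[of x] by (simp add: even[of x])
qed

lemma integral_mollifier:
  assumes "mollifier d \<rho>"
  shows "integrable lborel (\<lambda>y. \<rho> (x - y))" "(\<integral>y. \<rho> (x - y) \<partial>lborel) = 1"
proof -
  have cont: "continuous_on UNIV \<rho>"
    using assms by (simp add: mollifier_def test_function_continuous)
  have "integrable lborel (\<lambda>y. 1 *\<^sub>R \<rho> (x - y))"
    by (rule integrable_convolution_test[OF continuous_on_const cont, of d])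
      (use assms in \<open>simp add: mollifier_def\<close>)
  then show int: "integrable lborel (\<lambda>y. \<rho> (x - y))"
    by simp
  have "ennreal (\<integral>y. \<rho> (x - y) \<partial>lborel) = 1"
    using nn_integral_mollifier(1)[OF assms, of x] nn_integral_eq_integral[OF int] assms
    by (simp add: mollifier_def)
  then show "(\<integral>y. \<rho> (x - y) \<partial>lborel) = 1"
    by (metis ennreal_eq_1)
qed

text \<open>A substitute for Young's inequality that needs no conjugate exponent.\<close>

lemma powr_mult_le:
  fixes X Y :: real
  assumes "p > 1" "d > 0" "X \<ge> 0" "Y \<ge> 0"
  shows "X powr (p - 1) * Y \<le> d * X powr p + d powr (1 - p) * Y powr p"
\<comment> \<open>Whichever of \<open>Y\<close> and \<open>d * X\<close> is larger replaces the
  other, and the product is then at most one of the two summands.\<close>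
proof (cases "Y \<le> d * X")
  case True
  then have "X powr (p - 1) * Y \<le> X powr (p - 1) * (d * X)"
    by (intro mult_left_mono) auto
  also have "\<dots> = d * X powr p"
    using assms by (cases "X = 0") (auto simp: powr_diff)
  finally show ?thesis
    by (simp add: add_increasing2)
next
  case False
  then have "Y > 0" "X \<le> Y / d"
    using assms mult_nonneg_nonneg[of d X] by (auto simp: field_simps simp del: mult_nonneg_nonneg)
  then have "X powr (p - 1) * Y \<le> (Y / d) powr (p - 1) * Y"
    using assms by (intro mult_right_mono powr_mono2) auto
  also have "\<dots> = d powr (1 - p) * Y powr p"
    using assms \<open>Y > 0\<close> by (simp add: powr_divide powr_diff field_simps)
  finally show ?thesis
    using assms by (simp add: add_increasing)
qed

section \<open>Approximation in L^p and weighted convergence of mollifications\<close>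

lemma norm_add_powr_le:
  assumes "p > 0"
  shows "norm (a + b) powr p \<le> 2 powr p * (norm a powr p + norm b powr p)"
proof -
  have "norm (a + b) powr p \<le> (2 * max (norm a) (norm b)) powr p"
    using assms norm_triangle_ineq[of a b] by (intro powr_mono2) auto
  also have "\<dots> = 2 powr p * max (norm a) (norm b) powr p"
    by (simp add: powr_mult)
  also have "\<dots> \<le> 2 powr p * (norm a powr p + norm b powr p)"
    by (intro mult_left_mono) (auto simp: max_def)
  finally show ?thesis .
qed

text \<open>The radial retraction onto the closed ball of radius \<open>M\<close>; writing it with
  \<open>max\<close> instead of a case distinction makes continuity immediate.\<close>

definition clamp_norm :: "real \<Rightarrow> 'a::real_normed_vector \<Rightarrow> 'a" where
  "clamp_norm M z = (M / max M (norm z)) *\<^sub>R z"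

lemma clamp_norm:
  assumes "M > 0"
  shows "norm (clamp_norm M z) \<le> M" "norm z \<le> M \<Longrightarrow> clamp_norm M z = z"
    "norm (clamp_norm M z - z) \<le> norm z"
proof -
  show "norm (clamp_norm M z) \<le> M"
    using assms by (auto simp: clamp_norm_def max_def field_simps)
  show "norm z \<le> M \<Longrightarrow> clamp_norm M z = z"
    using assms by (simp add: clamp_norm_def max_def)
  have "clamp_norm M z - z = (M / max M (norm z) - 1) *\<^sub>R z"
    by (simp add: clamp_norm_def scaleR_diff_left)
  moreover have "\<bar>M / max M (norm z) - 1\<bar> \<le> 1"
  proof -
    have "M / max M (norm z) \<le> 1" "M / max M (norm z) \<ge> 0"
      using assms by (auto simp: divide_le_eq)
    then show ?thesis by (simp add: abs_le_iff)
  qed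
  ultimately show "norm (clamp_norm M z - z) \<le> norm z"
    by (simp add: mult_left_le_one_le)
qed

lemma continuous_on_clamp_norm:
  assumes "M > 0" "continuous_on S f"
  shows "continuous_on S (\<lambda>x. clamp_norm M (f x))"
  unfolding clamp_norm_def using assms by (intro continuous_intros) auto

lemma tendsto_norm_powr_0:
  assumes "(f \<longlongrightarrow> l) F" "p > 0"
  shows "((\<lambda>x. norm (f x - l) powr p) \<longlongrightarrow> 0) F"
  using tendsto_powr'[OF tendsto_norm_zero[OF LIM_zero[OF assms(1)]] tendsto_const, of p] assms(2)
    by simp

text \<open>Dominated convergence is used twice. First \<open>G\<close> is clamped at a high level
  \<open>M\<close>, with |G|^p as majorant. Then continuous functions converging to \<open>G\<close>
  almost everywhere are clamped at the same level, so that the constant (2 M)^p is a majorant on the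
  set \<open>B\<close> of finite measure.\<close>

lemma Lp_approximation_continuous:
  fixes G :: "'a::euclidean_space \<Rightarrow> 'b::euclidean_space"
  assumes G[measurable]: "G \<in> borel_measurable borel" and B[measurable]: "B \<in> sets borel"
    and Bfin: "emeasure lborel B < \<infinity>" and p: "p > 0"
    and fin: "(\<integral>\<^sup>+x\<in>B. ennreal (norm (G x) powr p) \<partial>lborel) < \<infinity>" and e: "e > (0::real)"
  obtains g where "continuous_on UNIV g" "(\<integral>\<^sup>+x\<in>B. ennreal (norm (G x - g x) powr p) \<partial>lborel) < ennreal e"
proof -
  define c :: ennreal where "c = ennreal (2 powr p)"
  \<comment> \<open>Each of the two errors is below \<open>e'\<close>, and the quasi-triangle
    inequality costs the factor 2^p; together this is e/2, which leaves the strict inequality with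
    \<open>e\<close>.\<close>
  define e' where "e' = ennreal (e / (4 * 2 powr p))"
  have "e' > 0"
    using e by (simp add: e'_def)
  have "c * (e' + e') = ennreal (2 powr p * (e / (4 * 2 powr p) + e / (4 * 2 powr p)))"
    unfolding c_def e'_def using e by (subst ennreal_plus[symmetric]) (simp_all only: ennreal_mult[symmetric] powr_ge_zero less_imp_le divide_nonneg_nonneg mult_nonneg_nonneg zero_le_numeral add_nonneg_nonneg)
  also have "\<dots> = ennreal (e / 2)"
    by (simp add: field_simps)
  also have "\<dots> < ennreal e"
    using e by (intro ennreal_lessI) auto
  finally have ce: "c * (e' + e') < ennreal e" .
  have "(\<lambda>n. \<integral>\<^sup>+x\<in>B. ennreal (norm (clamp_norm (real (Suc n)) (G x) - G x) powr p) \<partial>lborel)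
      \<longlonglongrightarrow> (\<integral>\<^sup>+x. 0 \<partial>(lborel :: 'a measure))"
  proof (rule nn_integral_dominated_convergence[OF _ _ _ _ fin])
    have [measurable]: "clamp_norm M \<in> borel_measurable borel" if "M > 0" for M :: real
      using continuous_on_clamp_norm[OF that continuous_on_id] by (rule borel_measurable_continuous_onI)
    show "(\<lambda>x. ennreal (norm (clamp_norm (real (Suc n)) (G x) - G x) powr p) * indicator B x)
        \<in> borel_measurable lborel" for n
      by measurable
    show "AE x in lborel. ennreal (norm (clamp_norm (real (Suc n)) (G x) - G x) powr p) * indicator B x
       \<le> ennreal (norm (G x) powr p) * indicator B x" for n
      using p by (auto intro!: mult_right_mono ennreal_leI powr_mono2 clamp_norm)
    show "AE x in lborel. (\<lambda>n. ennreal (norm (clamp_norm (real (Suc n)) (G x) - G x) powr p) * indicator B x) \<longlonglongrightarrow> 0"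
    proof (rule AE_I2, rule tendsto_eventually)
      fix x
      obtain N where "norm (G x) \<le> real N"
        using real_arch_simple by blast
      then have "clamp_norm (real (Suc n)) (G x) = G x" if "n \<ge> N" for n
        using that by (intro clamp_norm) auto
      then show "\<forall>\<^sub>F n in sequentially. ennreal (norm (clamp_norm (real (Suc n)) (G x) - G x) powr p) * indicator B x = 0"
        by (auto simp: eventually_sequentially intro!: exI[of _ N])
    qed
  qed auto
  then have "\<forall>\<^sub>F n in sequentially. (\<integral>\<^sup>+x\<in>B. ennreal (norm (clamp_norm (real (Suc n)) (G x) - G x) powr p) \<partial>lborel) < e'"
    using \<open>e' > 0\<close> by (simp add: order_tendsto_iff)
  then obtain n where n: "(\<integral>\<^sup>+x\<in>B. ennreal (norm (clamp_norm (real (Suc n)) (G x) - G x) powr p) \<partial>lborel) < e'"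
    unfolding eventually_sequentially by blast
  define M where "M = real (Suc n)"
  have "M > 0" by (simp add: M_def)
  have clamp_meas[measurable]: "clamp_norm M \<in> borel_measurable (borel :: 'b measure)"
    using continuous_on_clamp_norm[OF \<open>M > 0\<close> continuous_on_id]
      by (rule borel_measurable_continuous_onI)
  have "G \<in> borel_measurable lebesgue"
    by (rule measurable_completion) simp
  \<comment> \<open>This supplies continuous functions converging to \<open>G\<close> off a
    negligible set, but with no bound on them; hence the clamping.\<close>
  then have "G measurable_on UNIV"
    by (rule lebesgue_measurable_imp_measurable_on) simp
  then obtain N \<gamma> where N: "negligible N" and \<gamma>: "\<And>n. continuous_on UNIV (\<gamma> n)"
    "\<And>x. x \<notin> N \<Longrightarrow> (\<lambda>n. \<gamma> n x) \<longlonglongrightarrow> G x"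
    unfolding measurable_on_def by auto
  have [measurable]: "\<gamma> n \<in> borel_measurable borel" for n
    using \<gamma>(1) by (rule borel_measurable_continuous_onI)
  have "AE x in lebesgue. x \<notin> N"
    using N by (simp add: negligible_iff_null_sets AE_not_in)
  then have AE_N: "AE x in lborel. x \<notin> N"
    by (simp add: AE_completion_iff)
  have "(\<lambda>k. \<integral>\<^sup>+x\<in>B. ennreal (norm (clamp_norm M (\<gamma> k x) - clamp_norm M (G x)) powr p) \<partial>lborel)
      \<longlonglongrightarrow> (\<integral>\<^sup>+x. 0 \<partial>(lborel :: 'a measure))"
  proof (rule nn_integral_dominated_convergence)
    show "AE x in lborel. ennreal (norm (clamp_norm M (\<gamma> k x) - clamp_norm M (G x)) powr p) * indicator B x
       \<le> ennreal ((2 * M) powr p) * indicator B x" for k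
    proof (intro always_eventually allI mult_right_mono ennreal_leI powr_mono2)
      show "norm (clamp_norm M (\<gamma> k x) - clamp_norm M (G x)) \<le> 2 * M" for x
        using norm_triangle_ineq4[of "clamp_norm M (\<gamma> k x)" "clamp_norm M (G x)"]
          clamp_norm(1)[OF \<open>M > 0\<close>, of "\<gamma> k x"] clamp_norm(1)[OF \<open>M > 0\<close>, of "G x"] by linarith
    qed (use p in auto)
    show "(\<integral>\<^sup>+x\<in>B. ennreal ((2 * M) powr p) \<partial>lborel) < \<infinity>"
      using Bfin by (simp add: nn_integral_cmult ennreal_mult_less_top)
    show "AE x in lborel. (\<lambda>k. ennreal (norm (clamp_norm M (\<gamma> k x) - clamp_norm M (G x)) powr p) * indicator B x) \<longlonglongrightarrow> 0"
      using AE_N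
    proof eventually_elim
      case (elim x)
      have "isCont (clamp_norm M) (G x)"
        using continuous_on_clamp_norm[OF \<open>M > 0\<close> continuous_on_id, of "UNIV :: 'b set"]
        by (simp add: continuous_on_eq_continuous_at)
      from isCont_tendsto_compose[OF this \<gamma>(2)[OF elim]]
      have "(\<lambda>k. ennreal (norm (clamp_norm M (\<gamma> k x) - clamp_norm M (G x)) powr p)) \<longlonglongrightarrow> ennreal 0"
        using p by (intro tendsto_ennrealI tendsto_norm_powr_0)
      then show ?case
        by (auto split: split_indicator)
    qed
  qed auto
  then have "\<forall>\<^sub>F k in sequentially. (\<integral>\<^sup>+x\<in>B. ennreal (norm (clamp_norm M (\<gamma> k x) - clamp_norm M (G x)) powr p) \<partial>lborel) < e'"
    using \<open>e' > 0\<close> by (simp add: order_tendsto_iff)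
  then obtain k where k: "(\<integral>\<^sup>+x\<in>B. ennreal (norm (clamp_norm M (\<gamma> k x) - clamp_norm M (G x)) powr p) \<partial>lborel) < e'"
    unfolding eventually_sequentially by blast
  let ?g = "\<lambda>x. clamp_norm M (\<gamma> k x)"
  have "(\<integral>\<^sup>+x\<in>B. ennreal (norm (G x - ?g x) powr p) \<partial>lborel)
    \<le> (\<integral>\<^sup>+x. c * (ennreal (norm (?g x - clamp_norm M (G x)) powr p) * indicator B x
        + ennreal (norm (clamp_norm M (G x) - G x) powr p) * indicator B x) \<partial>lborel)"
  proof (rule nn_integral_mono)
    fix x
    have "norm (G x - ?g x) powr p \<le> 2 powr p * (norm (?g x - clamp_norm M (G x)) powr p
        + norm (clamp_norm M (G x) - G x) powr p)"
      using norm_add_powr_le[OF p, of "?g x - clamp_norm M (G x)" "clamp_norm M (G x) - G x"]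
      by (simp add: norm_minus_commute)
    then show "ennreal (norm (G x - ?g x) powr p) * indicator B x \<le>
       c * (ennreal (norm (?g x - clamp_norm M (G x)) powr p) * indicator B x
        + ennreal (norm (clamp_norm M (G x) - G x) powr p) * indicator B x)"
      by (auto simp: c_def ennreal_leI split: split_indicator simp flip: ennreal_mult ennreal_plus)
  qed
  also have "\<dots> = c * ((\<integral>\<^sup>+x\<in>B. ennreal (norm (?g x - clamp_norm M (G x)) powr p) \<partial>lborel)
     + (\<integral>\<^sup>+x\<in>B. ennreal (norm (clamp_norm M (G x) - G x) powr p) \<partial>lborel))"
    by (simp add: nn_integral_cmult nn_integral_add)
  also have "\<dots> \<le> c * (e' + e')"
    using k n by (intro mult_left_mono add_mono) (auto simp: M_def)
  also have "\<dots> < ennreal e" by (rule ce)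
  finally show ?thesis
    using that continuous_on_clamp_norm[OF \<open>M > 0\<close> \<gamma>(1)] by blast
qed

text \<open>Only the error multiplied by |G|^(p-1) is needed, the growth of the flux. Young's
  inequality applied inside the convolution integral, before integrating in \<open>x\<close>, turns
  everything into expressions linear in \<open>\<rho>\<close>, so that mass one and Fubini suffice.
  The increment G y - G x is compared with that of a continuous \<open>g\<close> close to
  \<open>G\<close> in L^p.\<close>

lemma mollification_converges_weighted:
  fixes G :: "'a::euclidean_space \<Rightarrow> 'b::euclidean_space"
  assumes G[measurable]: "G \<in> borel_measurable borel" and p: "p > 1" and e: "e > (0::real)"
    and loc: "\<And>S. set_integrable lborel (cball 0 S) G"
    and fin: "\<And>S. (\<integral>\<^sup>+x\<in>cball 0 S. ennreal (norm (G x) powr p) \<partial>lborel) < \<infinity>"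
  obtains d where "d > 0" "\<And>\<rho>. mollifier d \<rho> \<Longrightarrow> (\<integral>\<^sup>+x\<in>cball 0 S. ennreal (norm (G x) powr (p - 1) *
      norm ((\<integral>y. \<rho> (x - y) *\<^sub>R G y \<partial>lborel) - G x)) \<partial>lborel) \<le> ennreal e"
proof -
  define B B' where "B = cball (0::'a) S" and "B' = cball (0::'a) (S + 1)"
  have [measurable]: "B \<in> sets borel" "B' \<in> sets borel" and B': "compact B'" and "B \<subseteq> B'"
    by (auto simp: B_def B'_def)
  define K where "K = enn2real (\<integral>\<^sup>+x\<in>B. ennreal (norm (G x) powr p) \<partial>lborel)"
  have K: "(\<integral>\<^sup>+x\<in>B. ennreal (norm (G x) powr p) \<partial>lborel) = ennreal K" "K \<ge> 0"
    using fin[of S] by (simp_all add: K_def B_def)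
  define V where "V = measure lborel B"
  have V: "emeasure lborel B = ennreal V" "V \<ge> 0"
    unfolding V_def B_def using emeasure_eq_ennreal_measure emeasure_bounded_finite[of "cball 0 S"]
    by (auto simp: less_top)
  \<comment> \<open>Budget: the three pieces of the increment cost 3 \<delta> |G|^p in total, with
    integral at most e/3; the oscillation of \<open>g\<close> costs \<open>c * t\<close> per unit of
    volume, at most e/3; the distance from \<open>G\<close> to \<open>g\<close>, measured once at
    \<open>x\<close> and once at \<open>y\<close>, costs e/6 each time, whence the tolerance e/(6
    c).\<close>
  define \<delta> where "\<delta> = e / (9 * (K + 1))"
  have \<delta>: "\<delta> > 0" "3 * \<delta> * K \<le> e / 3"
    using e K by (auto simp: \<delta>_def divide_simps)
  define c where "c = \<delta> powr (1 - p)"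
  have c: "c > 0"
    using \<delta> by (simp add: c_def)
  define t where "t = e / (3 * c * (V + 1))"
  have t: "t > 0" "c * t * V \<le> e / 3"
    using e c V by (auto simp: t_def divide_simps)
  have young: "X powr (p - 1) * Y \<le> \<delta> * X powr p + c * Y powr p" if "X \<ge> 0" "Y \<ge> 0" for X Y
    using powr_mult_le[OF p \<delta>(1) that] by (simp add: c_def)
  obtain g where g: "continuous_on UNIV g"
    and gG: "(\<integral>\<^sup>+x\<in>B'. ennreal (norm (G x - g x) powr p) \<partial>lborel) < ennreal (e / (6 * c))"
  proof (rule Lp_approximation_continuous[of G B' p "e / (6 * c)"])
    show "emeasure lborel B' < \<infinity>"
      unfolding B'_def by (rule emeasure_bounded_finite) simp
    show "(\<integral>\<^sup>+x\<in>B'. ennreal (norm (G x) powr p) \<partial>lborel) < \<infinity>"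
      unfolding B'_def by (rule fin)
  qed (use p e c in auto)
  have [measurable]: "g \<in> borel_measurable borel"
    using g by (rule borel_measurable_continuous_onI)
  have "uniformly_continuous_on B' g"
    using B' continuous_on_subset[OF g subset_UNIV] by (rule compact_uniformly_continuous[rotated])
  then obtain d where "d > 0" and d: "\<And>x y. x \<in> B' \<Longrightarrow> y \<in> B' \<Longrightarrow> dist y x < d
      \<Longrightarrow> dist (g y) (g x) < t powr (1 / p)"
    unfolding uniformly_continuous_on_def using t(1) by (metis powr_gt_zero less_irrefl)
  \<comment> \<open>Cut off by the indicator so that it can be integrated over the whole space after
    the order of integration is exchanged.\<close>
  define D where "D x = indicator B' x * norm (G x - g x) powr p" for x
  have [measurable]: "D \<in> borel_measurable borel"
    unfolding D_def by measurable
  have D_nonneg: "D x \<ge> 0" for x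
    by (simp add: D_def)
  have DI: "(\<integral>\<^sup>+x. ennreal (D x) \<partial>lborel) \<le> ennreal (e / (6 * c))"
    using gG by (simp add: D_def indicator_mult_ennreal mult.commute less_imp_le)
  \<comment> \<open>All contributions that do not depend on \<open>y\<close>; they pass through the
    average against \<open>\<rho> (x - y)\<close> unchanged.\<close>
  define A where "A x = 3 * \<delta> * norm (G x) powr p + c * t + c * D x" for x
  have A_nonneg: "A x \<ge> 0" for x
    using \<delta> c t D_nonneg by (simp add: A_def)
  have [measurable]: "A \<in> borel_measurable borel"
    unfolding A_def by measurable
  have main: "(\<integral>\<^sup>+x\<in>B. ennreal (norm (G x) powr (p - 1) *
      norm ((\<integral>y. \<rho> (x - y) *\<^sub>R G y \<partial>lborel) - G x)) \<partial>lborel) \<le> ennreal e"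
    if \<rho>: "mollifier (min d 1) \<rho>" for \<rho>
  proof -
    have cont: "continuous_on UNIV \<rho>" and \<rho>0: "\<And>x. \<rho> x \<ge> 0" and \<rho>v: "\<And>x. norm x \<ge> min d 1 \<Longrightarrow> \<rho> x = 0"
      using \<rho> by (simp_all add: mollifier_def test_function_continuous)
    have [measurable]: "\<rho> \<in> borel_measurable borel"
      using cont by (rule borel_measurable_continuous_onI)
    have int: "integrable lborel (\<lambda>y. \<rho> (x - y) *\<^sub>R G y)" for x
      by (rule integrable_convolution_locally[OF loc G cont, of "min d 1"]) (simp add: \<rho>v)
    have pointwise: "norm (G x) powr (p - 1) * (\<rho> (x - y) * norm (G y - G x))
        \<le> \<rho> (x - y) * A x + c * (\<rho> (x - y) * D y)" if x: "x \<in> B" for x y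
    proof (cases "norm (x - y) < min d 1")
      case True
      \<comment> \<open>Since the mollifier has radius at most 1, \<open>y\<close> stays in the
        enlarged ball \<open>B'\<close>, where \<open>g\<close> is uniformly continuous.\<close>
      have "norm y \<le> norm x + norm (x - y)"
        by norm
      then have y: "y \<in> B'" and x': "x \<in> B'"
        using x True by (auto simp: B_def B'_def)
      let ?X = "norm (G x)"
      have "norm (g y - g x) \<le> t powr (1 / p)"
        using d[OF x' y] True by (simp add: dist_norm norm_minus_commute less_imp_le)
      then have "norm (g y - g x) powr p \<le> (t powr (1 / p)) powr p"
        using p by (intro powr_mono2) auto
      then have gt: "norm (g y - g x) powr p \<le> t"
        using p t by (simp add: powr_powr)
      have "norm (G y - G x) \<le> norm (G y - g y) + norm (g y - g x) + norm (G x - g x)"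
        by norm
      then have "?X powr (p - 1) * norm (G y - G x)
         \<le> ?X powr (p - 1) * (norm (G y - g y) + norm (g y - g x) + norm (G x - g x))"
        by (intro mult_left_mono) auto
      also have "\<dots> \<le> (\<delta> * ?X powr p + c * norm (G y - g y) powr p)
         + (\<delta> * ?X powr p + c * norm (g y - g x) powr p) + (\<delta> * ?X powr p
             + c * norm (G x - g x) powr p)"
        unfolding distrib_left by (intro add_mono young) auto
      also have "\<dots> \<le> A x + c * D y"
        using x' y gt c by (simp add: A_def D_def)
      finally have "\<rho> (x - y) * (?X powr (p - 1) * norm (G y - G x)) \<le> \<rho> (x - y) * (A x + c * D y)"
        using \<rho>0 by (rule mult_left_mono)
      then show ?thesis
        by (simp add: algebra_simps)
    next
      case False
      then show ?thesis
        by (simp only: \<rho>v[of "x - y"] not_less mult_zero_left mult_zero_right)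
    qed
    have inner: "ennreal (norm (G x) powr (p - 1) * norm ((\<integral>y. \<rho> (x - y) *\<^sub>R G y \<partial>lborel) - G x))
       \<le> ennreal (A x) + ennreal c * (\<integral>\<^sup>+y. ennreal (\<rho> (x - y) * D y) \<partial>lborel)" if x: "x \<in> B" for x
    proof -
      have i2: "integrable lborel (\<lambda>y. \<rho> (x - y) *\<^sub>R G x)"
        using integral_mollifier(1)[OF \<rho>, of x] by (rule integrable_scaleR_left)
      have "(\<integral>y. \<rho> (x - y) *\<^sub>R G y \<partial>lborel) - G x
         = (\<integral>y. \<rho> (x - y) *\<^sub>R G y \<partial>lborel) - (\<integral>y. \<rho> (x - y) *\<^sub>R G x \<partial>lborel)"
        using integral_mollifier[OF \<rho>, of x] by simp
      also have "\<dots> = (\<integral>y. \<rho> (x - y) *\<^sub>R (G y - G x) \<partial>lborel)"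
        using int i2 by (simp add: scaleR_diff_right)
      finally have eq: "(\<integral>y. \<rho> (x - y) *\<^sub>R G y \<partial>lborel) - G x
          = (\<integral>y. \<rho> (x - y) *\<^sub>R (G y - G x) \<partial>lborel)" .
      have "integrable lborel (\<lambda>y. \<rho> (x - y) *\<^sub>R (G y - G x))"
        using int i2 by (simp add: scaleR_diff_right)
      from integral_norm_bound_ennreal[OF this]
      have "ennreal (norm ((\<integral>y. \<rho> (x - y) *\<^sub>R G y \<partial>lborel) - G x))
          \<le> (\<integral>\<^sup>+y. ennreal (\<rho> (x - y) * norm (G y - G x)) \<partial>lborel)"
        by (simp add: eq \<rho>0)
      then have "ennreal (norm (G x) powr (p - 1) * norm ((\<integral>y. \<rho> (x - y) *\<^sub>R G y \<partial>lborel) - G x))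
         \<le> ennreal (norm (G x) powr (p - 1)) * (\<integral>\<^sup>+y. ennreal (\<rho> (x - y) * norm (G y - G x)) \<partial>lborel)"
        by (simp add: ennreal_mult mult_left_mono)
      also have "\<dots> = (\<integral>\<^sup>+y. ennreal (norm (G x) powr (p - 1) * (\<rho> (x - y) * norm (G y - G x))) \<partial>lborel)"
        by (simp add: ennreal_mult \<rho>0 nn_integral_cmult)
      also have "\<dots> \<le> (\<integral>\<^sup>+y. ennreal (\<rho> (x - y)) * ennreal (A x)
          + ennreal c * ennreal (\<rho> (x - y) * D y) \<partial>lborel)"
        using pointwise[OF x] \<rho>0 A_nonneg c D_nonneg
        by (intro nn_integral_mono) (simp add: ennreal_leI flip: ennreal_mult ennreal_plus)
      also have "\<dots> = ennreal (A x) + ennreal c * (\<integral>\<^sup>+y. ennreal (\<rho> (x - y) * D y) \<partial>lborel)"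
        by (simp add: nn_integral_add nn_integral_cmult nn_integral_multc nn_integral_mollifier[OF \<rho>])
      finally show ?thesis .
    qed
    \<comment> \<open>The term in \<open>y\<close> is integrated over \<open>x\<close> first, where
      the mollifier has mass one as well.\<close>
    have "(\<integral>\<^sup>+x. \<integral>\<^sup>+y. ennreal (\<rho> (x - y) * D y) \<partial>lborel \<partial>lborel)
        = (\<integral>\<^sup>+y. \<integral>\<^sup>+x. ennreal (\<rho> (x - y) * D y) \<partial>lborel \<partial>lborel)"
      by (rule lborel_pair.Fubini'[symmetric]) measurable
    also have "\<dots> = (\<integral>\<^sup>+y. ennreal (D y) \<partial>lborel)"
      by (simp add: ennreal_mult \<rho>0 D_nonneg nn_integral_multc nn_integral_mollifier[OF \<rho>])
    finally have swap: "(\<integral>\<^sup>+x. \<integral>\<^sup>+y. ennreal (\<rho> (x - y) * D y) \<partial>lborel \<partial>lborel) \<le> ennreal (e / (6 * c))"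
      using DI by simp
    have "(\<integral>\<^sup>+x\<in>B. ennreal (A x) \<partial>lborel)
        = (\<integral>\<^sup>+x. ennreal (3 * \<delta>) * (ennreal (norm (G x) powr p) * indicator B x)
       + (ennreal (c * t) * indicator B x + ennreal c * (ennreal (D x) * indicator B x)) \<partial>lborel)"
      using \<delta> c t D_nonneg
      by (intro nn_integral_cong)
       (auto simp: A_def split: split_indicator simp flip: ennreal_mult ennreal_plus)
    also have "\<dots> = ennreal (3 * \<delta>) * ennreal K + (ennreal (c * t) * ennreal V
       + ennreal c * (\<integral>\<^sup>+x\<in>B. ennreal (D x) \<partial>lborel))"
      by (simp add: nn_integral_add nn_integral_cmult K V)
    also have "\<dots> \<le> ennreal (e / 3) + (ennreal (e / 3) + ennreal c * ennreal (e / (6 * c)))"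
    proof (intro add_mono mult_left_mono)
      show "ennreal (3 * \<delta>) * ennreal K \<le> ennreal (e / 3)"
        using \<delta> K by (simp add: ennreal_leI flip: ennreal_mult)
      show "ennreal (c * t) * ennreal V \<le> ennreal (e / 3)"
        using c t V by (simp add: ennreal_leI flip: ennreal_mult)
      have "(\<integral>\<^sup>+x\<in>B. ennreal (D x) \<partial>lborel) \<le> (\<integral>\<^sup>+x. ennreal (D x) \<partial>lborel)"
        by (intro nn_integral_mono) (auto split: split_indicator)
      then show "(\<integral>\<^sup>+x\<in>B. ennreal (D x) \<partial>lborel) \<le> ennreal (e / (6 * c))"
        using DI by simp
    qed simp
    finally have AI: "(\<integral>\<^sup>+x\<in>B. ennreal (A x) \<partial>lborel)
        \<le> ennreal (e / 3) + (ennreal (e / 3) + ennreal c * ennreal (e / (6 * c)))" .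
    have "(\<integral>\<^sup>+x\<in>B. ennreal (norm (G x) powr (p - 1) *
        norm ((\<integral>y. \<rho> (x - y) *\<^sub>R G y \<partial>lborel) - G x)) \<partial>lborel)
      \<le> (\<integral>\<^sup>+x. ennreal (A x) * indicator B x
          + ennreal c * (\<integral>\<^sup>+y. ennreal (\<rho> (x - y) * D y) \<partial>lborel) \<partial>lborel)"
      using inner by (intro nn_integral_mono) (auto split: split_indicator)
    also have "\<dots> = (\<integral>\<^sup>+x\<in>B. ennreal (A x) \<partial>lborel)
        + ennreal c * (\<integral>\<^sup>+x. \<integral>\<^sup>+y. ennreal (\<rho> (x - y) * D y) \<partial>lborel \<partial>lborel)"
      by (simp add: nn_integral_add nn_integral_cmult)
    also have "\<dots> \<le> ennreal (e / 3) + (ennreal (e / 3) + ennreal c * ennreal (e / (6 * c)))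
        + ennreal c * ennreal (e / (6 * c))"
      using AI swap by (intro add_mono mult_left_mono) auto
    also have "\<dots> = ennreal (e / 3 + (e / 3 + c * (e / (6 * c))) + c * (e / (6 * c)))"
      using e c by (simp del: times_divide_eq_right flip: ennreal_mult ennreal_plus)
    also have "e / 3 + (e / 3 + c * (e / (6 * c))) + c * (e / (6 * c)) = e"
      using c by (simp add: field_simps)
    finally show ?thesis .
  qed
  show ?thesis
    using that[of "min d 1"] \<open>d > 0\<close> main by (simp add: B_def)
qed

section \<open>The anisotropic flux\<close>

text \<open>Off the origin the flux is H^(p-1) grad H. Euler's identity turns a(\<xi>) . \<xi> into
  H^p, and grad H is homogeneous of degree 0; both bounds then follow from extrema over the compact
  unit sphere.\<close>

lemma aniso_flux_bounds:
  fixes H :: "'a::euclidean_space \<Rightarrow> real"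
  assumes H: "Ck_on 2 (- {0}) H" "continuous_on UNIV H"
    and hom: "\<And>t \<xi>. t > 0 \<Longrightarrow> H (t *\<^sub>R \<xi>) = t * H \<xi>"
    and pos: "\<And>\<xi>. \<xi> \<in> sphere 0 1 \<Longrightarrow> H \<xi> > 0"
    and p: "p > 1"
  shows "aniso_flux H p \<in> borel_measurable borel"
    and "\<exists>c>0. \<forall>\<xi>. c * norm \<xi> powr p \<le> aniso_flux H p \<xi> \<bullet> \<xi>"
    and "\<exists>C>0. \<forall>\<xi>. norm (aniso_flux H p \<xi>) \<le> C * norm \<xi> powr (p - 1)"
proof -
  have deriv: "GDERIV H \<xi> :> gradient H \<xi>" if "\<xi> \<noteq> 0" for \<xi>
    using H(1) that by (intro GDERIV_gradient) (simp add: numeral_2_eq_2)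
  have normalize: "H \<xi> = norm \<xi> * H (sgn \<xi>)" if "\<xi> \<noteq> 0" for \<xi>
    using hom[of "norm \<xi>" "sgn \<xi>"] that by (simp add: sgn_div_norm)
  have sgn_sphere: "sgn \<xi> \<in> sphere 0 1" if "\<xi> \<noteq> 0" for \<xi> :: 'a
    using that by (simp add: norm_sgn)
  have H_pos: "H \<xi> > 0" if "\<xi> \<noteq> 0" for \<xi>
    using normalize[OF that] pos[OF sgn_sphere[OF that]] that by simp
  \<comment> \<open>Two ways of differentiating t -> H(t \<xi>) = t H(\<xi>) at t = 1.\<close>
  have euler: "gradient H \<xi> \<bullet> \<xi> = H \<xi>" if \<xi>: "\<xi> \<noteq> 0" for \<xi>
  proof -
    have "(H has_derivative (\<lambda>h. h \<bullet> gradient H \<xi>)) (at (1 *\<^sub>R \<xi>))"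
      using deriv[OF \<xi>] by (simp add: gderiv_def)
    moreover have "((\<lambda>t. t *\<^sub>R \<xi>) has_derivative (\<lambda>s. s *\<^sub>R \<xi>)) (at 1)"
      by (auto intro!: derivative_eq_intros)
    ultimately have "((\<lambda>t. H (t *\<^sub>R \<xi>)) has_derivative (\<lambda>s. (s *\<^sub>R \<xi>) \<bullet> gradient H \<xi>)) (at 1)"
      by (rule has_derivative_compose[rotated])
    then have "((\<lambda>t. H (t *\<^sub>R \<xi>)) has_real_derivative \<xi> \<bullet> gradient H \<xi>) (at 1)"
      by (simp add: has_field_derivative_def mult.commute[of _ "\<xi> \<bullet> _"])
    moreover have "((\<lambda>t. H (t *\<^sub>R \<xi>)) has_real_derivative H \<xi>) (at 1)"
    proof (rule has_field_derivative_transform_within_open[where S="{0<..}"])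
      show "((\<lambda>t. t * H \<xi>) has_real_derivative H \<xi>) (at 1)"
        by (auto intro!: derivative_eq_intros)
    qed (auto simp: hom)
    ultimately show ?thesis
      by (metis DERIV_unique inner_commute)
  qed
  have grad_hom: "gradient H \<xi> = gradient H (sgn \<xi>)" if \<xi>: "\<xi> \<noteq> 0" for \<xi>
  proof -
    have "(H has_derivative (\<lambda>h. h \<bullet> gradient H (sgn \<xi>))) (at ((1 / norm \<xi>) *\<^sub>R \<xi>))"
      using deriv[of "sgn \<xi>"] \<xi> by (simp add: gderiv_def sgn_div_norm divide_inverse)
    moreover have "((\<lambda>x. (1 / norm \<xi>) *\<^sub>R x) has_derivative (\<lambda>h. (1 / norm \<xi>) *\<^sub>R h)) (at \<xi>)"
      by (auto intro!: derivative_eq_intros)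
    ultimately have "((\<lambda>x. H ((1 / norm \<xi>) *\<^sub>R x))
        has_derivative (\<lambda>h. ((1 / norm \<xi>) *\<^sub>R h) \<bullet> gradient H (sgn \<xi>))) (at \<xi>)"
      by (rule has_derivative_compose[rotated])
    then have "((\<lambda>x. norm \<xi> * H ((1 / norm \<xi>) *\<^sub>R x))
        has_derivative (\<lambda>h. norm \<xi> * (((1 / norm \<xi>) *\<^sub>R h) \<bullet> gradient H (sgn \<xi>)))) (at \<xi>)"
      by (rule has_derivative_mult_right)
    moreover have "(\<lambda>x. norm \<xi> * H ((1 / norm \<xi>) *\<^sub>R x)) = H"
      using \<xi> by (simp add: hom)
    ultimately have "GDERIV H \<xi> :> gradient H (sgn \<xi>)"
      using \<xi> by (simp add: gderiv_def)
    then show ?thesis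
      by (rule gradient_eqI)
  qed
  have grad_cont: "continuous_on (- {0}) (gradient H)"
  proof -
    have "continuous_on (- {0}) (\<lambda>x. gradient H x \<bullet> b)" if "b \<in> Basis" for b
    proof (rule differentiable_imp_continuous_on)
      have "\<forall>x\<in>- {0}. (\<lambda>x. gradient H x \<bullet> b) differentiable (at x)"
        using H(1) that by (simp add: numeral_2_eq_2)
      then show "(\<lambda>x. gradient H x \<bullet> b) differentiable_on (- {0})"
        by (simp add: differentiable_on_def differentiable_at_withinI)
    qed
    then have "continuous_on (- {0}) (\<lambda>x. \<Sum>b\<in>Basis. (gradient H x \<bullet> b) *\<^sub>R b)"
      by (intro continuous_on_sum continuous_on_scaleR continuous_on_const)
    then show ?thesis
      by (simp add: euclidean_representation)
  qed
  have flux: "aniso_flux H p \<xi> = H \<xi> powr (p - 1) *\<^sub>R gradient H \<xi>" if \<xi>: "\<xi> \<noteq> 0" for \<xi>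
  proof -
    have "((\<lambda>t. t powr p) has_real_derivative p * H \<xi> powr (p - 1)) (at (H \<xi>))"
      using H_pos[OF \<xi>] by (auto intro!: derivative_eq_intros)
    then have "GDERIV (\<lambda>x. H x powr p) \<xi> :> (p * H \<xi> powr (p - 1)) *\<^sub>R gradient H \<xi>"
      by (rule GDERIV_DERIV_compose[OF deriv[OF \<xi>]])
    then show ?thesis
      using \<xi> p by (simp add: aniso_flux_def gradient_eqI)
  qed
  have sphere: "compact (sphere (0::'a) 1)" "sphere (0::'a) 1 \<noteq> {}"
    by auto
  have "continuous_on (sphere 0 1) H"
    using H(2) by (rule continuous_on_subset) simp
  from continuous_attains_inf[OF sphere this] obtain \<xi>0
    where \<xi>0: "\<xi>0 \<in> sphere 0 1" "\<And>\<xi>. \<xi> \<in> sphere 0 1 \<Longrightarrow> H \<xi>0 \<le> H \<xi>"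
    by blast
  from continuous_attains_sup[OF sphere \<open>continuous_on (sphere 0 1) H\<close>] obtain \<xi>1
    where \<xi>1: "\<xi>1 \<in> sphere 0 1" "\<And>\<xi>. \<xi> \<in> sphere 0 1 \<Longrightarrow> H \<xi> \<le> H \<xi>1"
    by blast
  have "continuous_on (sphere 0 1) (\<lambda>x. norm (gradient H x))"
    by (intro continuous_on_norm continuous_on_subset[OF grad_cont]) auto
  from continuous_attains_sup[OF sphere this] obtain \<xi>2
    where \<xi>2: "\<And>\<xi>. \<xi> \<in> sphere 0 1 \<Longrightarrow> norm (gradient H \<xi>) \<le> norm (gradient H \<xi>2)"
    by blast
  have "continuous_on (- {0}) (\<lambda>x. H x powr (p - 1) *\<^sub>R gradient H x)"
    using H_pos by (intro continuous_intros grad_cont continuous_on_subset[OF H(2)]) force+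
  then have "continuous_on (- {0}) (aniso_flux H p)"
    by (rule continuous_on_cong[THEN iffD1, rotated 2]) (auto simp: flux)
  then show "aniso_flux H p \<in> borel_measurable borel"
    \<comment> \<open>The origin is the single exceptional point.\<close>
    by (rule borel_measurable_continuous_countable_exceptions[rotated]) simp
  show "\<exists>c>0. \<forall>\<xi>. c * norm \<xi> powr p \<le> aniso_flux H p \<xi> \<bullet> \<xi>"
  proof (intro exI conjI allI)
    show "H \<xi>0 powr p > 0"
      using pos[OF \<xi>0(1)] by simp
    show "H \<xi>0 powr p * norm \<xi> powr p \<le> aniso_flux H p \<xi> \<bullet> \<xi>" for \<xi>
    proof (cases "\<xi> = 0")
      case False
      have "H \<xi>0 * norm \<xi> \<le> H \<xi>"
        using \<xi>0(2)[OF sgn_sphere[OF False]]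
        by (subst normalize[OF False]) (simp add: mult.commute[of _ "norm \<xi>"] mult_left_mono)
      then have "(H \<xi>0 * norm \<xi>) powr p \<le> H \<xi> powr p"
        using pos[OF \<xi>0(1)] p by (intro powr_mono2) auto
      also have "\<dots> = aniso_flux H p \<xi> \<bullet> \<xi>"
        using H_pos[OF False] by (simp add: flux[OF False] euler[OF False] powr_diff)
      finally show ?thesis
        using pos[OF \<xi>0(1)] by (simp add: powr_mult)
    qed simp
  qed
  show "\<exists>C>0. \<forall>\<xi>. norm (aniso_flux H p \<xi>) \<le> C * norm \<xi> powr (p - 1)"
  proof (intro exI conjI allI)
    \<comment> \<open>The summand 1 makes the constant positive without any argument that the
      gradient is nonzero.\<close>
    show "H \<xi>1 powr (p - 1) * (norm (gradient H \<xi>2) + 1) > 0"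
      using pos[OF \<xi>1(1)] by (intro mult_pos_pos add_nonneg_pos) auto
    show "norm (aniso_flux H p \<xi>) \<le> H \<xi>1 powr (p - 1) * (norm (gradient H \<xi>2)
        + 1) * norm \<xi> powr (p - 1)" for \<xi>
    proof (cases "\<xi> = 0")
      case False
      have "H \<xi> \<le> H \<xi>1 * norm \<xi>"
        using \<xi>1(2)[OF sgn_sphere[OF False]]
        by (subst normalize[OF False]) (simp add: mult.commute[of _ "norm \<xi>"] mult_left_mono)
      then have "H \<xi> powr (p - 1) \<le> (H \<xi>1 * norm \<xi>) powr (p - 1)"
        using H_pos[OF False] p by (intro powr_mono2) auto
      moreover have "norm (gradient H \<xi>) \<le> norm (gradient H \<xi>2) + 1"
        using \<xi>2[OF sgn_sphere[OF False]] by (simp add: grad_hom[OF False])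
      ultimately have "H \<xi> powr (p - 1) * norm (gradient H \<xi>)
          \<le> (H \<xi>1 * norm \<xi>) powr (p - 1) * (norm (gradient H \<xi>2) + 1)"
        by (intro mult_mono) auto
      then show ?thesis
        using pos[OF \<xi>1(1)] by (simp add: flux[OF False] powr_mult mult.commute mult.left_commute)
    qed (simp add: aniso_flux_def)
  qed
qed

section \<open>Testing with a truncation of the supersolution\<close>

lemma mollifier_mono: "mollifier d \<rho> \<Longrightarrow> d \<le> d' \<Longrightarrow> mollifier d' \<rho>"
  by (auto simp: mollifier_def)

lemma mollification_pointwise_close:
  fixes u :: "'a::euclidean_space \<Rightarrow> real"
  assumes u: "continuous_on UNIV u" and \<rho>: "mollifier d \<rho>"
    and close: "\<And>y. norm (x - y) < d \<Longrightarrow> \<bar>u y - u x\<bar> \<le> e"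
  shows "\<bar>(\<integral>y. u y * \<rho> (x - y) \<partial>lborel) - u x\<bar> \<le> e"
proof -
  have cont: "continuous_on UNIV \<rho>" and \<rho>0: "\<And>x. \<rho> x \<ge> 0" and \<rho>v: "\<And>x. norm x \<ge> d \<Longrightarrow> \<rho> x = 0"
    using \<rho> by (simp_all add: mollifier_def test_function_continuous)
  note one = integral_mollifier[OF \<rho>, of x]
  have int: "integrable lborel (\<lambda>y. u y * \<rho> (x - y))"
    using integrable_convolution_test[OF u cont, of d x] \<rho>v by simp
  have int2: "integrable lborel (\<lambda>y. u x * \<rho> (x - y))"
    using one(1) by simp
  have "(\<integral>y. u y * \<rho> (x - y) \<partial>lborel) - u x = (\<integral>y. u y * \<rho> (x - y) - u x * \<rho> (x - y) \<partial>lborel)"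
    using one int int2 by simp
  also have "\<bar>\<dots>\<bar> \<le> (\<integral>y. e * \<rho> (x - y) \<partial>lborel)"
  proof -
    have bound: "norm (u y * \<rho> (x - y) - u x * \<rho> (x - y)) \<le> e * \<rho> (x - y)" for y
    proof (cases "norm (x - y) < d")
      case True
      then show ?thesis
        using mult_right_mono[OF close \<rho>0] by (simp add: abs_mult \<rho>0 flip: left_diff_distrib)
    qed (simp add: \<rho>v)
    have "norm (\<integral>y. u y * \<rho> (x - y) - u x * \<rho> (x - y) \<partial>lborel) \<le> (\<integral>y. e * \<rho> (x - y) \<partial>lborel)"
      by (rule order_trans[OF Bochner_Integration.integral_norm_bound integral_mono[OF
              integrable_norm[OF Bochner_Integration.integrable_diff[OF int int2]] integrable_mult_right[OF one(1)] bound]])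
    then show ?thesis by simp
  qed
  also have "\<dots> = e"
    using one by simp
  finally show ?thesis .
qed

lemma mollification_tendsto:
  fixes u :: "'a::euclidean_space \<Rightarrow> real"
  assumes u: "continuous_on UNIV u" and \<rho>: "\<And>n. mollifier (1 / real (Suc n)) (\<rho> n)"
  shows "(\<lambda>n. \<integral>y. u y * \<rho> n (x - y) \<partial>lborel) \<longlonglongrightarrow> u x"
proof (rule LIMSEQ_I)
  fix e :: real assume "e > 0"
  obtain d where "d > 0" and d: "\<And>y. dist y x < d \<Longrightarrow> dist (u y) (u x) < e / 2"
    using u \<open>e > 0\<close> unfolding continuous_on_iff by (metis UNIV_I half_gt_zero)
  obtain N where N: "1 / real (Suc N) < d"
    using nat_approx_posE[OF \<open>d > 0\<close>] by blast
  have "norm ((\<integral>y. u y * \<rho> n (x - y) \<partial>lborel) - u x) < e" if "n \<ge> N" for n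
  proof -
    have "1 / real (Suc n) \<le> 1 / real (Suc N)"
      using that by (intro divide_left_mono) auto
    then have "\<bar>(\<integral>y. u y * \<rho> n (x - y) \<partial>lborel) - u x\<bar> \<le> e / 2"
      using d N by (intro mollification_pointwise_close[OF u \<rho>[of n]])
        (simp add: dist_norm norm_minus_commute less_imp_le)
    then show ?thesis
      using \<open>e > 0\<close> by simp
  qed
  then show "\<exists>N. \<forall>n\<ge>N. norm ((\<integral>y. u y * \<rho> n (x - y) \<partial>lborel) - u x) < e"
    by blast
qed

text \<open>\<open>F\<close> stands for f(u) and \<open>A\<close> for the flux. \<open>J\<close> is
  the formal expansion of A(G) . grad (w \<eta>); its second term is negative because the truncation
  decreases in \<open>u\<close>. The inequality is the limit of the admissible ones in which
  \<open>u\<close> is mollified inside the truncation, while A(G) is kept as it is.\<close>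

lemma truncated_test_inequality:
  fixes u F :: "'a::euclidean_space \<Rightarrow> real" and G A :: "'a \<Rightarrow> 'a" and k :: real
  assumes u: "continuous_on UNIV u" and F: "continuous_on UNIV F" and p: "p > 1"
    and G[measurable]: "G \<in> borel_measurable borel" and A[measurable]: "A \<in> borel_measurable borel"
    and loc: "\<And>S. set_integrable lborel (cball 0 S) G"
    and locp: "\<And>S. set_integrable lborel (cball 0 S) (\<lambda>x. norm (G x) powr p)"
    and weak: "\<And>\<phi> b. test_function \<phi> \<Longrightarrow> b \<in> Basis \<Longrightarrow>
      (\<integral>x. u x * (gradient \<phi> x \<bullet> b) \<partial>lborel) = - (\<integral>x. (G x \<bullet> b) * \<phi> x \<partial>lborel)"
    and A_le: "\<And>\<xi>. norm (A \<xi>) \<le> C * norm \<xi> powr (p - 1)" and C: "C > 0"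
    and super: "\<And>\<phi>. test_function \<phi> \<Longrightarrow> (\<And>x. 0 \<le> \<phi> x) \<Longrightarrow>
      (\<integral>x. F x * \<phi> x \<partial>lborel) \<le> (\<integral>x. A (G x) \<bullet> gradient \<phi> x \<partial>lborel)"
    and \<eta>: "test_function \<eta>" "\<And>x. 0 \<le> \<eta> x"
  defines "w \<equiv> \<lambda>x. smooth_step (k - u x)"
    and "J \<equiv> \<lambda>x. smooth_step (k - u x) * (A (G x) \<bullet> gradient \<eta> x)
        - smooth_step_deriv (k - u x) * \<eta> x * (A (G x) \<bullet> G x)"
  shows "integrable lborel J" and "(\<integral>x. F x * (w x * \<eta> x) \<partial>lborel) \<le> (\<integral>x. J x \<partial>lborel)"
proof -
  obtain S where S: "\<And>x. norm x > S \<Longrightarrow> \<eta> x = 0"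
    using \<eta>(1) by (rule test_function_vanishing) blast
  note grad0 = gradient_eq_0_outside[where \<phi>=\<eta>, OF S]
  define B where "B = cball (0::'a) S"
  have [measurable]: "B \<in> sets borel" by (simp add: B_def)
  have outside: "\<eta> x = 0" "gradient \<eta> x = 0" if "x \<notin> B" for x
    using that S grad0 by (auto simp: B_def)
  obtain M1 where M1: "M1 \<ge> 0" "\<And>x. norm (\<eta> x) \<le> M1"
    by (rule bounded_continuous_vanishing[OF test_function_continuous[OF \<eta>(1)] S]) (assumption | rule that)+
  obtain M2 where M2: "M2 \<ge> 0" "\<And>x. norm (gradient \<eta> x) \<le> M2"
    by (rule bounded_continuous_vanishing[OF test_function_gradient_continuous[OF \<eta>(1)] grad0]) (assumption | rule that)+
  have [measurable]: "u \<in> borel_measurable borel" "F \<in> borel_measurable borel" "\<eta> \<in> borel_measurable borel"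
    "gradient \<eta> \<in> borel_measurable borel" "smooth_step \<in> borel_measurable borel"
    "smooth_step_deriv \<in> borel_measurable borel"
    using u F \<eta>(1)
    by (simp_all add: borel_measurable_continuous_onI test_function_continuous test_function_gradient_continuous
        continuous_on_smooth_step continuous_on_smooth_step_deriv)
  define g where "g x = indicator B x * norm (G x) powr p" for x
  have g_int: "integrable lborel g"
    using locp[of S] by (simp add: g_def[abs_def] set_integrable_def B_def)
  have B_int: "integrable lborel (indicator B :: 'a \<Rightarrow> real)"
    unfolding B_def by (intro integrable_real_indicator emeasure_bounded_finite) auto
  have fin: "(\<integral>\<^sup>+x\<in>cball 0 S. ennreal (norm (G x) powr p) \<partial>lborel) < \<infinity>" for S
  proof -
    have "(\<integral>\<^sup>+x\<in>cball 0 S. ennreal (norm (G x) powr p) \<partial>lborel)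
       = (\<integral>\<^sup>+x. ennreal (norm (indicator (cball 0 S) x *\<^sub>R norm (G x) powr p)) \<partial>lborel)"
      by (intro nn_integral_cong) (auto split: split_indicator)
    also have "\<dots> < \<infinity>"
      using locp[of S] unfolding set_integrable_def integrable_iff_bounded by blast
    finally show ?thesis .
  qed
  \<comment> \<open>Makes the term with grad \<eta> integrable over \<open>B\<close> from local
    integrability of |G|^p alone.\<close>
  have pow_le: "norm (G x) powr (p - 1) \<le> 1 + norm (G x) powr p" for x
  proof (cases "norm (G x) \<le> 1")
    case True
    then have "norm (G x) powr (p - 1) \<le> 1"
      using p by (intro powr_le1) auto
    then show ?thesis by (simp add: add_increasing2)
  next
    case False
    then have "norm (G x) powr (p - 1) \<le> norm (G x) powr p"
      by (intro powr_mono) auto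
    then show ?thesis by simp
  qed
  have AG: "\<bar>A (G x) \<bullet> G x\<bar> \<le> C * norm (G x) powr p" for x
  proof -
    have "\<bar>A (G x) \<bullet> G x\<bar> \<le> norm (A (G x)) * norm (G x)"
      by (rule Cauchy_Schwarz_ineq2)
    also have "\<dots> \<le> C * norm (G x) powr (p - 1) * norm (G x)"
      by (intro mult_right_mono A_le) auto
    also have "\<dots> = C * norm (G x) powr p"
      by (cases "G x = 0") (auto simp: powr_diff)
    finally show ?thesis .
  qed
  \<comment> \<open>One mollifier for two purposes: its radius yields pointwise convergence of the
    mollified \<open>u\<close>, and the weighted error controls its gradient.\<close>
  have "\<exists>\<rho>. mollifier (1 / real (Suc n)) \<rho> \<and> (\<integral>\<^sup>+x\<in>B. ennreal (norm (G x) powr (p - 1) *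
      norm ((\<integral>y. \<rho> (x - y) *\<^sub>R G y \<partial>lborel) - G x)) \<partial>lborel) \<le> ennreal (1 / real (Suc n))" for n
  proof -
    have "1 / real (Suc n) > 0" by simp
    from mollification_converges_weighted[OF G p this loc fin]
    obtain d where d: "d > 0" "\<And>\<rho>. mollifier d \<rho> \<Longrightarrow> (\<integral>\<^sup>+x\<in>cball 0 S. ennreal (norm (G x) powr (p - 1) *
      norm ((\<integral>y. \<rho> (x - y) *\<^sub>R G y \<partial>lborel) - G x)) \<partial>lborel) \<le> ennreal (1 / real (Suc n))"
      by blast
    obtain \<rho> :: "'a \<Rightarrow> real" where "mollifier (min d (1 / real (Suc n))) \<rho>"
      using mollifier_exists[of "min d (1 / real (Suc n))"] d(1) by auto
    then show ?thesis
      using d(2)[of \<rho>] mollifier_mono[of _ \<rho>] by (intro exI[of _ \<rho>]) (auto simp: B_def)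
  qed
  then have "\<forall>n. \<exists>\<rho>. mollifier (1 / real (Suc n)) \<rho> \<and> (\<integral>\<^sup>+x\<in>B. ennreal (norm (G x) powr (p - 1) *
      norm ((\<integral>y. \<rho> (x - y) *\<^sub>R G y \<partial>lborel) - G x)) \<partial>lborel) \<le> ennreal (1 / real (Suc n))"
    by blast
  from choice[OF this] obtain \<rho> where \<rho>: "\<And>n. mollifier (1 / real (Suc n)) (\<rho> n)"
    and \<rho>_conv: "\<And>n. (\<integral>\<^sup>+x\<in>B. ennreal (norm (G x) powr (p - 1) *
      norm ((\<integral>y. \<rho> n (x - y) *\<^sub>R G y \<partial>lborel) - G x)) \<partial>lborel) \<le> ennreal (1 / real (Suc n))"
    by blast
  have \<rho>_test: "test_function (\<rho> n)" for n
    using \<rho>[of n] by (simp add: mollifier_def)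
  define un where "un n x = (\<integral>y. u y * \<rho> n (x - y) \<partial>lborel)" for n x
  define Gn where "Gn n x = (\<integral>y. \<rho> n (x - y) *\<^sub>R G y \<partial>lborel)" for n x
  have un_Ck: "Ck_on j UNIV (un n)" for j n
    unfolding un_def[abs_def] by (rule Ck_on_convolution[OF u \<rho>_test])
  have un_grad: "gradient (un n) = Gn n" for n
    unfolding un_def[abs_def] Gn_def[abs_def]
    by (intro ext gradient_convolution[OF u \<rho>_test loc G weak])
  have un_cont: "continuous_on UNIV (un n)" for n
    by (rule Ck_on_imp_continuous[OF un_Ck])
  then have [measurable]: "un n \<in> borel_measurable borel" for n
    by (rule borel_measurable_continuous_onI)
  have un_lim: "(\<lambda>n. un n x) \<longlonglongrightarrow> u x" for x
    unfolding un_def by (rule mollification_tendsto[OF u \<rho>])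
  have [measurable]: "Gn n \<in> borel_measurable borel" for n
  proof -
    have [measurable]: "\<rho> n \<in> borel_measurable borel"
      by (rule borel_measurable_continuous_onI[OF test_function_continuous[OF \<rho>_test]])
    show ?thesis unfolding Gn_def[abs_def] by measurable
  qed
  define \<phi> where "\<phi> n x = smooth_step (k - un n x) * \<eta> x" for n x
  have step_lim: "(\<lambda>n. smooth_step (k - un n x)) \<longlonglongrightarrow> smooth_step (k - u x)"
    "(\<lambda>n. smooth_step_deriv (k - un n x)) \<longlonglongrightarrow> smooth_step_deriv (k - u x)" for x
    by (intro continuous_on_tendsto_compose[OF continuous_on_smooth_step[of UNIV]]
        continuous_on_tendsto_compose[OF continuous_on_smooth_step_deriv[of UNIV]]
        tendsto_diff tendsto_const un_lim; simp)+
  have shift: "Ck_on j UNIV (\<lambda>x. smooth_step (k - un n x))" for j n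
  proof -
    have "Ck_on j UNIV (\<lambda>x. smooth_step (k + (- 1) * un n x))"
      by (rule Ck_on_smooth_step[OF Ck_on_add[OF Ck_on_const Ck_on_mult[OF Ck_on_const un_Ck]]])
    then show ?thesis by simp
  qed
  have \<phi>_test: "test_function (\<phi> n)" for n
  proof -
    have "Ck_on j UNIV (\<phi> n)" for j
      unfolding \<phi>_def[abs_def] by (rule Ck_on_mult[OF shift test_function_Ck[OF \<eta>(1)]])
    moreover have "\<forall>x. norm x > S \<longrightarrow> \<phi> n x = 0"
      using S by (simp add: \<phi>_def)
    ultimately show ?thesis
      unfolding test_function_iff by blast
  qed
  have \<phi>_grad: "gradient (\<phi> n) x = smooth_step (k - un n x) *\<^sub>R gradient \<eta> x
      + \<eta> x *\<^sub>R ((- smooth_step_deriv (k - un n x)) *\<^sub>R Gn n x)" for n x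
  proof (rule gradient_eqI)
    have "GDERIV (un n) x :> Gn n x"
      using Ck_on_GDERIV[OF un_Ck] by (simp add: un_grad)
    moreover have "((\<lambda>t. smooth_step (k - t)) has_real_derivative - smooth_step_deriv (k - un n x)) (at (un n x))"
    proof -
      have "((\<lambda>t. k - t) has_real_derivative - 1) (at (un n x))"
        by (auto intro!: derivative_eq_intros)
      from DERIV_chain2[OF DERIV_smooth_step this] show ?thesis by simp
    qed
    ultimately have "GDERIV (\<lambda>x. smooth_step (k - un n x)) x :> (- smooth_step_deriv (k - un n x)) *\<^sub>R Gn n x"
      by (rule GDERIV_DERIV_compose)
    then show "GDERIV (\<phi> n) x :> smooth_step (k - un n x) *\<^sub>R gradient \<eta> x
      + \<eta> x *\<^sub>R ((- smooth_step_deriv (k - un n x)) *\<^sub>R Gn n x)"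
      unfolding \<phi>_def[abs_def] by (rule GDERIV_mult[OF _ test_function_GDERIV[OF \<eta>(1)]])
  qed
  \<comment> \<open>Writing \<open>Gn n\<close> as G + (Gn n - G) confines the approximate gradient
    to \<open>J3\<close>. The other two involve only the pointwise convergent \<open>un n\<close>
    and have fixed majorants.\<close>
  define J1 J2 J3 where "J1 n x = smooth_step (k - un n x) * (A (G x) \<bullet> gradient \<eta> x)"
    and "J2 n x = smooth_step_deriv (k - un n x) * \<eta> x * (A (G x) \<bullet> G x)"
    and "J3 n x = smooth_step_deriv (k - un n x) * \<eta> x * (A (G x) \<bullet> (Gn n x - G x))" for n x
  \<comment> \<open>Stated for an arbitrary factor \<open>s\<close>, so that it covers the
    approximations as well as the limit.\<close>
  have J1_bound: "norm (s * (A (G x) \<bullet> gradient \<eta> x)) \<le> M2 * C * (indicator B x + g x)"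
      if "0 \<le> s" "s \<le> 1" for s x
  proof (cases "x \<in> B")
    case True
    have "\<bar>A (G x) \<bullet> gradient \<eta> x\<bar> \<le> norm (A (G x)) * norm (gradient \<eta> x)"
      by (rule Cauchy_Schwarz_ineq2)
    also have "\<dots> \<le> (C * (1 + norm (G x) powr p)) * M2"
      using A_le[of "G x"] pow_le[of x] C
        by (intro mult_mono M2 order_trans[OF A_le] mult_left_mono) auto
    finally have "\<bar>A (G x) \<bullet> gradient \<eta> x\<bar> \<le> M2 * C * (indicator B x + g x)"
      using True by (simp add: g_def mult.commute mult.left_commute)
    then show ?thesis
      using that mult_left_le_one_le[of "\<bar>A (G x) \<bullet> gradient \<eta> x\<bar>" s] by (simp add: abs_mult)
  qed (simp add: outside g_def)
  have J2_bound: "norm (s * \<eta> x * (A (G x) \<bullet> G x)) \<le> 8 * M1 * C * g x" if "0 \<le> s" "s \<le> 8" for s x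
  proof (cases "x \<in> B")
    case True
    have "\<bar>s\<bar> * \<bar>\<eta> x\<bar> * \<bar>A (G x) \<bullet> G x\<bar> \<le> 8 * M1 * (C * norm (G x) powr p)"
      using that M1 AG by (intro mult_mono) auto
    then show ?thesis
      using True by (simp add: abs_mult g_def mult.assoc)
  qed (simp add: outside g_def)
  have J3_bound: "ennreal (norm (J3 n x))
      \<le> ennreal (8 * M1 * C) * (ennreal (norm (G x) powr (p - 1) * norm (Gn n x - G x)) * indicator B x)" for n x
  proof (cases "x \<in> B")
    case True
    have "\<bar>A (G x) \<bullet> (Gn n x - G x)\<bar> \<le> norm (A (G x)) * norm (Gn n x - G x)"
      by (rule Cauchy_Schwarz_ineq2)
    also have "\<dots> \<le> C * norm (G x) powr (p - 1) * norm (Gn n x - G x)"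
      by (intro mult_right_mono A_le) auto
    finally have "\<bar>smooth_step_deriv (k - un n x)\<bar> * \<bar>\<eta> x\<bar> * \<bar>A (G x) \<bullet> (Gn n x - G x)\<bar>
       \<le> 8 * M1 * (C * norm (G x) powr (p - 1) * norm (Gn n x - G x))"
      using M1 smooth_step_deriv_le_8 by (intro mult_mono) auto
    then have "norm (J3 n x) \<le> 8 * M1 * C * (norm (G x) powr (p - 1) * norm (Gn n x - G x))"
      by (simp add: J3_def abs_mult mult.assoc)
    then show ?thesis
      using True M1 C by (simp add: ennreal_leI flip: ennreal_mult)
  qed (simp add: J3_def outside)
  have dominated: "integrable lborel f" if "f \<in> borel_measurable borel" "\<And>x. norm (f x) \<le> h x"
    "integrable lborel h" for f h :: "'a \<Rightarrow> real"
    using that(1) by (intro Bochner_Integration.integrable_bound[OF that(3)])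
      (auto intro!: AE_I2 order_trans[OF that(2)[unfolded real_norm_def]])
  have dom1: "integrable lborel (\<lambda>x. M2 * C * (indicator B x + g x))"
    using g_int B_int by simp
  have dom2: "integrable lborel (\<lambda>x. 8 * M1 * C * g x)"
    using g_int by simp
  have [measurable]: "J1 n \<in> borel_measurable borel" "J2 n \<in> borel_measurable borel" "J3 n \<in> borel_measurable borel" for n
    unfolding J1_def[abs_def] J2_def[abs_def] J3_def[abs_def] by measurable
  have J1_int: "integrable lborel (J1 n)" for n
    by (rule dominated[OF _ _ dom1]) (simp_all only: J1_def J1_bound smooth_step_nonneg smooth_step_le_1, measurable)
  have J2_int: "integrable lborel (J2 n)" for n
    by (rule dominated[OF _ _ dom2]) (simp_all only: J2_def J2_bound smooth_step_deriv_nonneg smooth_step_deriv_le_8, measurable)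
  have J3_nn: "(\<integral>\<^sup>+x. ennreal (norm (J3 n x)) \<partial>lborel) \<le> ennreal (8 * M1 * C * (1 / real (Suc n)))"
      for n
  proof -
    have "(\<integral>\<^sup>+x. ennreal (norm (J3 n x)) \<partial>lborel)
      \<le> (\<integral>\<^sup>+x. ennreal (8 * M1 * C) * (ennreal (norm (G x) powr (p - 1) * norm (Gn n x - G x)) * indicator B x) \<partial>lborel)"
      by (intro nn_integral_mono J3_bound)
    also have "\<dots> = ennreal (8 * M1 * C) * (\<integral>\<^sup>+x\<in>B. ennreal (norm (G x) powr (p - 1) * norm (Gn n x - G x)) \<partial>lborel)"
      by (intro nn_integral_cmult) measurable
    also have "\<dots> \<le> ennreal (8 * M1 * C) * ennreal (1 / real (Suc n))"
      unfolding Gn_def by (intro mult_left_mono \<rho>_conv) auto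
    also have "\<dots> = ennreal (8 * M1 * C * (1 / real (Suc n)))"
      using M1 C by (intro ennreal_mult[symmetric]) auto
    finally show ?thesis .
  qed
  have J3_int: "integrable lborel (J3 n)" for n
    unfolding integrable_iff_bounded using le_less_trans[OF J3_nn ennreal_less_top] by simp
  have J3_le: "norm (\<integral>x. J3 n x \<partial>lborel) \<le> 8 * M1 * C * (1 / real (Suc n))" for n
  proof -
    have "ennreal (norm (\<integral>x. J3 n x \<partial>lborel)) \<le> ennreal (8 * M1 * C * (1 / real (Suc n)))"
      using integral_norm_bound_ennreal[OF J3_int] J3_nn by (rule order_trans)
    then show ?thesis
      using M1 C by (subst (asm) ennreal_le_iff) auto
  qed
  have "(\<lambda>n. 8 * M1 * C * (1 / real (Suc n))) \<longlonglongrightarrow> 0"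
    using tendsto_mult[OF tendsto_const LIMSEQ_Suc[OF lim_1_over_n], of "8 * M1 * C"] by simp
  then have J3_lim: "(\<lambda>n. \<integral>x. J3 n x \<partial>lborel) \<longlonglongrightarrow> 0"
    by (rule Lim_null_comparison[OF always_eventually[OF allI[OF J3_le]]])
  define J1' J2' where "J1' x = smooth_step (k - u x) * (A (G x) \<bullet> gradient \<eta> x)"
    and "J2' x = smooth_step_deriv (k - u x) * \<eta> x * (A (G x) \<bullet> G x)" for x
  have [measurable]: "J1' \<in> borel_measurable borel" "J2' \<in> borel_measurable borel"
    unfolding J1'_def[abs_def] J2'_def[abs_def] by measurable
  have J1_lim: "(\<lambda>n. \<integral>x. J1 n x \<partial>lborel) \<longlonglongrightarrow> (\<integral>x. J1' x \<partial>lborel)"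
  proof (rule integral_dominated_convergence[OF _ _ dom1])
    show "AE x in lborel. (\<lambda>n. J1 n x) \<longlonglongrightarrow> J1' x"
      unfolding J1_def J1'_def by (intro AE_I2 tendsto_mult step_lim tendsto_const)
    show "AE x in lborel. norm (J1 n x) \<le> M2 * C * (indicator B x + g x)" for n
      unfolding J1_def by (intro AE_I2 J1_bound) auto
  qed auto
  have J2_lim: "(\<lambda>n. \<integral>x. J2 n x \<partial>lborel) \<longlonglongrightarrow> (\<integral>x. J2' x \<partial>lborel)"
  proof (rule integral_dominated_convergence[OF _ _ dom2])
    show "AE x in lborel. (\<lambda>n. J2 n x) \<longlonglongrightarrow> J2' x"
      unfolding J2_def J2'_def by (intro AE_I2 tendsto_mult step_lim tendsto_const)
    show "AE x in lborel. norm (J2 n x) \<le> 8 * M1 * C * g x" for n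
      unfolding J2_def by (intro AE_I2 J2_bound smooth_step_deriv_le_8) auto
  qed auto
  have J1'_int: "integrable lborel J1'"
    by (rule dominated[OF _ _ dom1]) (simp_all only: J1'_def J1_bound smooth_step_nonneg smooth_step_le_1, measurable)
  have J2'_int: "integrable lborel J2'"
    by (rule dominated[OF _ _ dom2]) (simp_all only: J2'_def J2_bound smooth_step_deriv_nonneg smooth_step_deriv_le_8, measurable)
  have J_eq: "J = (\<lambda>x. J1' x - J2' x)"
    by (simp add: J_def J1'_def J2'_def)
  show "integrable lborel J"
    unfolding J_eq using J1'_int J2'_int by (rule Bochner_Integration.integrable_diff)
  have domF: "integrable lborel (\<lambda>x. \<bar>F x * \<eta> x\<bar>)"
  proof (rule integrable_continuous_vanishing[of _ S])
    show "continuous_on UNIV (\<lambda>x. \<bar>F x * \<eta> x\<bar>)"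
      by (intro continuous_on_rabs continuous_on_mult F test_function_continuous \<eta>)
  qed (simp add: S)
  have F_lim: "(\<lambda>n. \<integral>x. F x * \<phi> n x \<partial>lborel) \<longlonglongrightarrow> (\<integral>x. F x * (w x * \<eta> x) \<partial>lborel)"
  proof (rule integral_dominated_convergence[OF _ _ domF])
    show "AE x in lborel. (\<lambda>n. F x * \<phi> n x) \<longlonglongrightarrow> F x * (w x * \<eta> x)"
      unfolding \<phi>_def w_def by (intro AE_I2 tendsto_mult step_lim tendsto_const)
    show "AE x in lborel. norm (F x * \<phi> n x) \<le> \<bar>F x * \<eta> x\<bar>" for n
    proof (intro AE_I2)
      fix x
      have "smooth_step (k - un n x) * \<bar>F x * \<eta> x\<bar> \<le> 1 * \<bar>F x * \<eta> x\<bar>"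
        by (intro mult_right_mono) auto
      then show "norm (F x * \<phi> n x) \<le> \<bar>F x * \<eta> x\<bar>"
        by (simp add: \<phi>_def abs_mult mult.commute mult.left_commute)
    qed
  qed (auto simp: \<phi>_def[abs_def] w_def)
  have ineq: "(\<integral>x. F x * \<phi> n x \<partial>lborel)
      \<le> (\<integral>x. J1 n x \<partial>lborel) - (\<integral>x. J2 n x \<partial>lborel) - (\<integral>x. J3 n x \<partial>lborel)" for n
  proof -
    have "(\<integral>x. F x * \<phi> n x \<partial>lborel) \<le> (\<integral>x. A (G x) \<bullet> gradient (\<phi> n) x \<partial>lborel)"
      by (rule super[OF \<phi>_test]) (simp add: \<phi>_def \<eta>(2))
    also have "\<dots> = (\<integral>x. J1 n x - J2 n x - J3 n x \<partial>lborel)"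
      by (intro Bochner_Integration.integral_cong)
        (simp_all add: \<phi>_grad J1_def J2_def J3_def inner_add_right inner_diff_right algebra_simps)
    also have "\<dots> = (\<integral>x. J1 n x \<partial>lborel) - (\<integral>x. J2 n x \<partial>lborel) - (\<integral>x. J3 n x \<partial>lborel)"
      using J1_int J2_int J3_int by simp
    finally show ?thesis .
  qed
  have "(\<integral>x. F x * (w x * \<eta> x) \<partial>lborel) \<le> (\<integral>x. J1' x \<partial>lborel) - (\<integral>x. J2' x \<partial>lborel) - 0"
    by (rule LIMSEQ_le[OF F_lim tendsto_diff[OF tendsto_diff[OF J1_lim J2_lim] J3_lim]]) (use ineq in blast)
  then show "(\<integral>x. F x * (w x * \<eta> x) \<partial>lborel) \<le> (\<integral>x. J x \<partial>lborel)"
    using J1'_int J2'_int by (simp add: J_eq)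
qed

lemma lebesgue_measurable_AE_borel:
  fixes f :: "'a::euclidean_space \<Rightarrow> 'b::euclidean_space"
  assumes f[measurable]: "f \<in> borel_measurable lebesgue"
  obtains g where "g \<in> borel_measurable borel" "AE x in lborel. f x = g x"
proof -
  have "\<exists>h\<in>borel_measurable lborel. AE x in lborel. f x \<bullet> b = h x" for b
    by (rule completion_ex_borel_measurable_real) measurable
  then obtain h where h: "\<And>b. h b \<in> borel_measurable lborel" "\<And>b. AE x in lborel. f x \<bullet> b = h b x"
    by metis
  have [measurable]: "h b \<in> borel_measurable borel" for b
    using h(1)[of b] by simp
  have "AE x in lborel. \<forall>b\<in>Basis. f x \<bullet> b = h b x"
    using h(2) by (intro AE_finite_allI) auto
  then have "AE x in lborel. f x = (\<Sum>b\<in>Basis. h b x *\<^sub>R b)"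
  proof eventually_elim
    case (elim x)
    then show ?case
      using euclidean_representation[of "f x"] by simp
  qed
  then show ?thesis
    by (rule that[rotated]) measurable
qed

lemma integral_lebesgue_eq_lborel:
  fixes f g :: "'a::euclidean_space \<Rightarrow> real"
  assumes "f \<in> borel_measurable lebesgue" "g \<in> borel_measurable borel" "AE x in lborel. f x = g x"
  shows "integral\<^sup>L lebesgue f = integral\<^sup>L lborel g" "integrable lebesgue f \<longleftrightarrow> integrable lborel g"
proof -
  have g: "g \<in> borel_measurable lborel" "g \<in> borel_measurable lebesgue"
    using assms(2) by (auto intro: measurable_completion)
  have ae: "AE x in lebesgue. f x = g x"
    using assms(3) by (rule AE_completion)
  show "integral\<^sup>L lebesgue f = integral\<^sup>L lborel g"
    using integral_cong_AE[OF assms(1) g(2) ae] integral_completion[OF g(1)] by simp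
  show "integrable lebesgue f \<longleftrightarrow> integrable lborel g"
    using integrable_cong_AE[OF assms(1) g(2) ae] integrable_completion[OF g(1)] by simp
qed

text \<open>The definitions integrate over \<open>lebesgue\<close>, whereas translation and Fubini
  are applied over \<open>lborel\<close> to Borel functions. A Borel version of the weak gradient
  differs from it on a null set only, so none of the integrals changes.\<close>

lemma supersolution_borel_gradient:
  fixes u :: "'a::euclidean_space \<Rightarrow> real"
  assumes super: "supersolution H p f u"
    and A[measurable]: "aniso_flux H p \<in> borel_measurable borel"
    and F: "continuous_on UNIV (\<lambda>x. f (u x))"
  obtains G where "G \<in> borel_measurable borel" "\<And>S. set_integrable lborel (cball 0 S) G"
    "\<And>S. set_integrable lborel (cball 0 S) (\<lambda>x. norm (G x) powr p)"
    "\<And>\<phi> b. test_function \<phi> \<Longrightarrow> b \<in> Basis \<Longrightarrow>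
      (\<integral>x. u x * (gradient \<phi> x \<bullet> b) \<partial>lborel) = - (\<integral>x. (G x \<bullet> b) * \<phi> x \<partial>lborel)"
    "\<And>\<phi>. test_function \<phi> \<Longrightarrow> (\<And>x. 0 \<le> \<phi> x) \<Longrightarrow>
      (\<integral>x. f (u x) * \<phi> x \<partial>lborel) \<le> (\<integral>x. aniso_flux H p (G x) \<bullet> gradient \<phi> x \<partial>lborel)"
proof -
  obtain G0 where u: "continuous_on UNIV u" and W: "W1p_loc_with_gradient p u G0"
    and ineq: "\<And>\<phi>. test_function \<phi> \<Longrightarrow> (\<And>x. 0 \<le> \<phi> x) \<Longrightarrow>
      (\<integral>x. f (u x) * \<phi> x \<partial>lebesgue) \<le> (\<integral>x. aniso_flux H p (G0 x) \<bullet> gradient \<phi> x \<partial>lebesgue)"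
    using super unfolding supersolution_def by auto
  have G0[measurable]: "G0 \<in> borel_measurable lebesgue"
    and loc1: "\<And>K. compact K \<Longrightarrow> set_integrable lebesgue K (\<lambda>x. norm (G0 x) powr 1)"
    and locp: "\<And>K. compact K \<Longrightarrow> set_integrable lebesgue K (\<lambda>x. norm (G0 x) powr p)"
    and weak: "\<And>\<phi> b. test_function \<phi> \<Longrightarrow> b \<in> Basis \<Longrightarrow>
      (\<integral>x. u x * (gradient \<phi> x \<bullet> b) \<partial>lebesgue) = - (\<integral>x. (G0 x \<bullet> b) * \<phi> x \<partial>lebesgue)"
    using W by (auto simp: W1p_loc_with_gradient_def has_weak_gradient_def Lp_loc_def)
  obtain G where G[measurable]: "G \<in> borel_measurable borel" and ae: "AE x in lborel. G0 x = G x"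
    using G0 by (rule lebesgue_measurable_AE_borel)
  have [measurable]: "cball (0::'a) S \<in> sets borel" for S
    by (rule borel_closed) (rule closed_cball)
  have loc: "set_integrable lborel (cball 0 S) (\<lambda>x. norm (G x) powr q)"
    if "set_integrable lebesgue (cball 0 S) (\<lambda>x. norm (G0 x) powr q)" for S q
    unfolding set_integrable_def
  proof (rule integral_lebesgue_eq_lborel(2)[THEN iffD1])
    show "integrable lebesgue (\<lambda>x. indicator (cball 0 S) x *\<^sub>R norm (G0 x) powr q)"
      using that by (simp add: set_integrable_def)
    then show "(\<lambda>x. indicator (cball 0 S) x *\<^sub>R norm (G0 x) powr q) \<in> borel_measurable lebesgue"
      by (rule borel_measurable_integrable)
    show "AE x in lborel. indicator (cball 0 S) x *\<^sub>R norm (G0 x) powr q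
        = indicator (cball 0 S) x *\<^sub>R norm (G x) powr q"
      using ae by eventually_elim simp
  qed measurable
  have int_G: "set_integrable lborel (cball 0 S) G" for S
    unfolding set_integrable_def
  proof (rule integrable_norm_cancel)
    \<comment> \<open>\<open>Lp_loc 1\<close> is phrased with \<open>powr 1\<close>, which on norms
      is the identity, also at 0.\<close>
    have "(\<lambda>x. norm (indicator (cball 0 S) x *\<^sub>R G x))
        = (\<lambda>x. indicator (cball 0 S) x *\<^sub>R norm (G x) powr 1)"
      by (auto split: split_indicator)
    then show "integrable lborel (\<lambda>x. norm (indicator (cball 0 S) x *\<^sub>R G x))"
      using loc[of S 1] loc1 by (simp add: set_integrable_def)
  qed measurable
  have weak_G: "(\<integral>x. u x * (gradient \<phi> x \<bullet> b) \<partial>lborel) = - (\<integral>x. (G x \<bullet> b) * \<phi> x \<partial>lborel)"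
    if \<phi>: "test_function \<phi>" and b: "b \<in> Basis" for \<phi> b
  proof -
    have [measurable]: "u \<in> borel_measurable borel" "\<phi> \<in> borel_measurable borel" "gradient \<phi> \<in> borel_measurable borel"
      using u \<phi> by (simp_all add: borel_measurable_continuous_onI test_function_continuous test_function_gradient_continuous)
    have [measurable]: "\<phi> \<in> borel_measurable lebesgue"
      by (rule measurable_completion) simp
    have "(\<integral>x. u x * (gradient \<phi> x \<bullet> b) \<partial>lebesgue) = (\<integral>x. u x * (gradient \<phi> x \<bullet> b) \<partial>lborel)"
      by (rule integral_completion) measurable
    moreover have "(\<integral>x. (G0 x \<bullet> b) * \<phi> x \<partial>lebesgue) = (\<integral>x. (G x \<bullet> b) * \<phi> x \<partial>lborel)"
    proof (rule integral_lebesgue_eq_lborel(1))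
      show "AE x in lborel. (G0 x \<bullet> b) * \<phi> x = (G x \<bullet> b) * \<phi> x"
        using ae by eventually_elim simp
    qed measurable
    ultimately show ?thesis
      using weak[OF \<phi> b] by simp
  qed
  have super_G: "(\<integral>x. f (u x) * \<phi> x \<partial>lborel) \<le> (\<integral>x. aniso_flux H p (G x) \<bullet> gradient \<phi> x \<partial>lborel)"
    if \<phi>: "test_function \<phi>" and \<phi>0: "\<And>x. 0 \<le> \<phi> x" for \<phi>
  proof -
    have [measurable]: "(\<lambda>x. f (u x)) \<in> borel_measurable borel" "\<phi> \<in> borel_measurable borel" "gradient \<phi> \<in> borel_measurable borel"
      using F \<phi> by (simp_all add: borel_measurable_continuous_onI test_function_continuous test_function_gradient_continuous)
    have [measurable]: "gradient \<phi> \<in> borel_measurable lebesgue"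
      by (rule measurable_completion) simp
    have "(\<integral>x. f (u x) * \<phi> x \<partial>lebesgue) = (\<integral>x. f (u x) * \<phi> x \<partial>lborel)"
      by (rule integral_completion) measurable
    moreover have "(\<integral>x. aniso_flux H p (G0 x) \<bullet> gradient \<phi> x \<partial>lebesgue)
        = (\<integral>x. aniso_flux H p (G x) \<bullet> gradient \<phi> x \<partial>lborel)"
    proof (rule integral_lebesgue_eq_lborel(1))
      show "AE x in lborel. aniso_flux H p (G0 x) \<bullet> gradient \<phi> x = aniso_flux H p (G x) \<bullet> gradient \<phi> x"
        using ae by eventually_elim simp
    qed measurable
    ultimately show ?thesis
      using ineq[OF \<phi> \<phi>0] by simp
  qed
  show ?thesis
  proof (rule that[OF G])
    show "set_integrable lborel (cball 0 S) (\<lambda>x. norm (G x) powr p)" for S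
      by (rule loc[OF locp[OF compact_cball]])
  qed (rule int_G | rule weak_G; assumption | rule super_G; blast)+
qed

section \<open>Lower bound for f, decay under doubling, and absorption\<close>

lemma positive_lower_bound:
  fixes f :: "real \<Rightarrow> real"
  assumes pos: "\<And>x. x > 0 \<Longrightarrow> f x > 0" and cont: "continuous_on {0<..} f"
    and liminf: "Liminf (at_right 0) (\<lambda>x. ereal (f x)) > 0"
  obtains c where "c > 0" "\<And>x. 0 < x \<Longrightarrow> x \<le> k \<Longrightarrow> c \<le> f x"
proof -
  \<comment> \<open>The liminf settles a neighbourhood of 0, where compactness gives nothing; on the
    remaining \<open>{d..k}\<close> a minimum is attained.\<close>
  obtain e where e: "0 < ereal e" "ereal e < Liminf (at_right 0) (\<lambda>x. ereal (f x))"
    using ereal_dense2[OF liminf] by blast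
  from less_LiminfD[OF e(2)] obtain d where d: "d > 0" "\<And>x. 0 < x \<Longrightarrow> x < d \<Longrightarrow> e < f x"
    unfolding eventually_at_right_field by auto
  have near: "e \<le> f x" if "0 < x" "x < d" for x
    using d(2)[OF that] by simp
  have "\<exists>c>0. \<forall>x\<in>{d..k}. c \<le> f x"
  proof (cases "d \<le> k")
    case True
    have "continuous_on {d..k} f"
      using d(1) by (intro continuous_on_subset[OF cont]) auto
    then obtain z where "z \<in> {d..k}" "\<forall>x\<in>{d..k}. f z \<le> f x"
      using continuous_attains_inf[of "{d..k}" f] True by auto
    then show ?thesis
      using pos[of z] d(1) by auto
  qed (auto intro: exI[of _ 1])
  then obtain c where "c > 0" "\<forall>x\<in>{d..k}. c \<le> f x"
    by blast
  then show ?thesis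
    using that[of "min c e"] e(1) near by (force simp: min_le_iff_disj not_less)
qed

text \<open>For large R each doubling gains a factor \<theta>, while the growth bound loses 2^n.
  With \<theta> = 2^(-n-1) there is a net factor 1/2 per doubling, and infinitely many doublings
  leave 0.\<close>

lemma superpolynomial_decay_imp_zero:
  fixes I :: "real \<Rightarrow> real"
  assumes nonneg: "\<And>R. R > 0 \<Longrightarrow> 0 \<le> I R" and growth: "\<And>R. R > 0 \<Longrightarrow> I R \<le> V * R ^ n"
    and decay: "\<And>R. R > 0 \<Longrightarrow> I R \<le> K * R powr (- p) * I (2 * R)" and p: "p > 0"
  obtains R where "R > 0" "I R = 0"
proof -
  define \<theta> :: real where "\<theta> = (1 / 2) ^ Suc n"
  have \<theta>: "\<theta> > 0" by (simp add: \<theta>_def)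
  have "((\<lambda>R. K * R powr (- p)) \<longlongrightarrow> K * 0) at_top"
    using p by (intro tendsto_mult tendsto_const tendsto_neg_powr filterlim_ident) auto
  then have "\<forall>\<^sub>F R in at_top. K * R powr (- p) < \<theta>"
    using \<theta> by (simp add: order_tendsto_iff)
  then obtain R1 where R1: "\<And>R. R \<ge> R1 \<Longrightarrow> K * R powr (- p) < \<theta>"
    unfolding eventually_at_top_linorder by blast
  define R where "R = max R1 1"
  have R: "R > 0" "R \<ge> R1" by (auto simp: R_def)
  have iter: "I R \<le> \<theta> ^ j * I (2 ^ j * R)" for j
  proof (induction j)
    case (Suc j)
    have pos: "2 ^ j * R > 0" using R by simp
    have "1 * R \<le> 2 ^ j * R"
      using R by (intro mult_right_mono) auto
    then have "K * (2 ^ j * R) powr (- p) \<le> \<theta>"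
      using R by (intro R1[THEN less_imp_le]) linarith
    then have "K * (2 ^ j * R) powr (- p) * I (2 * (2 ^ j * R)) \<le> \<theta> * I (2 * (2 ^ j * R))"
      using pos by (intro mult_right_mono nonneg) auto
    then have "I (2 ^ j * R) \<le> \<theta> * I (2 * (2 ^ j * R))"
      using decay[OF pos] by linarith
    then have "\<theta> ^ j * I (2 ^ j * R) \<le> \<theta> ^ j * (\<theta> * I (2 * (2 ^ j * R)))"
      using \<theta> by (intro mult_left_mono) auto
    then show ?case
      using Suc.IH by (simp add: mult.assoc mult.left_commute mult.commute)
  qed simp
  have "I R \<le> V * R ^ n * (1 / 2) ^ j" for j
  proof -
    have "I R \<le> \<theta> ^ j * (V * (2 ^ j * R) ^ n)"
      using R \<theta> by (intro order_trans[OF iter[of j]] mult_left_mono growth) auto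
    also have "\<theta> ^ j * (V * (2 ^ j * R) ^ n) = V * R ^ n * (\<theta> * 2 ^ n) ^ j"
      by (simp add: power_mult_distrib mult.assoc mult.left_commute flip: power_mult)
    also have "\<theta> * 2 ^ n = 1 / 2"
      by (simp add: \<theta>_def power_divide)
    finally show ?thesis .
  qed
  moreover have "(\<lambda>j. V * R ^ n * (1 / 2 :: real) ^ j) \<longlonglongrightarrow> V * R ^ n * 0"
    by (intro tendsto_mult tendsto_const LIMSEQ_power_zero) simp
  ultimately have "I R \<le> V * R ^ n * 0"
    by (intro LIMSEQ_le_const) auto
  then show ?thesis
    using that[of R] nonneg[of R] R by simp
qed

text \<open>The chain rule contributes 2 |x| / r^2, at most 2/r on the ball, and
  \<open>smooth_step_deriv_le\<close> the rest. The power (p-1)/p of the bump is the form that the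
  absorption consumes.\<close>

lemma norm_gradient_radial_bump_le:
  fixes x :: "'a::euclidean_space"
  assumes "r > 0" "p > 1"
  shows "norm (gradient (\<lambda>x. smooth_step (1 - (norm x / r)\<^sup>2)) x)
    \<le> 4 * p\<^sup>2 / r * smooth_step (1 - (norm x / r)\<^sup>2) powr ((p - 1) / p)"
proof -
  let ?s = "1 - (norm x / r)\<^sup>2"
  have "GDERIV (\<lambda>x::'a. 1 - (x \<bullet> x) / r\<^sup>2) x :> - (2 / r\<^sup>2) *\<^sub>R x"
    unfolding gderiv_def using assms
    by (auto intro!: derivative_eq_intros ext simp: inner_commute field_simps)
  moreover have "(\<lambda>x::'a. 1 - (x \<bullet> x) / r\<^sup>2) = (\<lambda>x. 1 - (norm x / r)\<^sup>2)"
    by (simp add: power_divide dot_square_norm)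
  ultimately have "GDERIV (\<lambda>x::'a. 1 - (norm x / r)\<^sup>2) x :> - (2 / r\<^sup>2) *\<^sub>R x"
    by simp
  from GDERIV_DERIV_compose[OF this DERIV_smooth_step]
  have grad: "gradient (\<lambda>x. smooth_step (1 - (norm x / r)\<^sup>2)) x
      = smooth_step_deriv ?s *\<^sub>R (- (2 / r\<^sup>2) *\<^sub>R x)"
    by (rule gradient_eqI)
  show ?thesis
  proof (cases "norm x \<le> r")
    case True
    have "norm (gradient (\<lambda>x. smooth_step (1 - (norm x / r)\<^sup>2)) x)
        = smooth_step_deriv ?s * (2 * norm x / r\<^sup>2)"
      unfolding grad by simp
    also have "\<dots> \<le> smooth_step_deriv ?s * (2 / r)"
      using True assms by (intro mult_left_mono) (auto simp: field_simps power2_eq_square)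
    also have "\<dots> \<le> (2 * p\<^sup>2 * smooth_step ?s powr ((p - 1) / p)) * (2 / r)"
      using assms by (intro mult_right_mono smooth_step_deriv_le) auto
    finally show ?thesis
      by (simp add: mult.assoc mult.left_commute mult.commute)
  next
    case False
    then have "norm x / r > 1"
      using assms by simp
    then have "(norm x / r)\<^sup>2 > 1"
      by (rule one_less_power) simp
    then show ?thesis
      unfolding grad using assms by (simp add: smooth_step_deriv_def)
  qed
qed

text \<open>Meant for X = |grad u| and N = |grad \<eta>|. Young's parameter d = \<kappa> \<eta> / C
  makes the X^p terms cancel exactly; the remainder contains d^(1-p) N^p, in which the powers of
  \<eta> cancel because N^p \<le> L^p \<eta>^(p-1).\<close>

lemma absorb_gradient_term:
  fixes X N :: real
  assumes p: "p > 1" and C: "C > 0" and \<kappa>: "\<kappa> > 0" and X: "X \<ge> 0" and N: "N \<ge> 0" and \<eta>: "\<eta> \<ge> 0"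
    and L: "L \<ge> 0" "N \<le> L * \<eta> powr ((p - 1) / p)"
  shows "C * X powr (p - 1) * N - \<kappa> * X powr p * \<eta> \<le> C * (\<kappa> / C) powr (1 - p) * L powr p"
proof (cases "\<eta> = 0")
  case True
  \<comment> \<open>The value \<open>0 powr a = 0\<close> turns the bound on \<open>N\<close> into N
    = 0.\<close>
  then have "N = 0" using N L by simp
  then show ?thesis using True C by simp
next
  case False
  then have "\<eta> > 0" using \<eta> by simp
  define d where "d = \<kappa> * \<eta> / C"
  have d: "d > 0" using \<kappa> C \<open>\<eta> > 0\<close> by (simp add: d_def)
  have "N powr p \<le> (L * \<eta> powr ((p - 1) / p)) powr p"
    using N L p by (intro powr_mono2) auto
  also have "\<dots> = L powr p * \<eta> powr (p - 1)"
    using p L by (simp add: powr_mult powr_powr)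
  finally have "d powr (1 - p) * N powr p \<le> d powr (1 - p) * (L powr p * \<eta> powr (p - 1))"
    by (rule mult_left_mono) simp
  also have "\<dots> = (\<kappa> / C) powr (1 - p) * L powr p * (\<eta> powr (1 - p) * \<eta> powr (p - 1))"
    using \<kappa> C \<open>\<eta> > 0\<close> by (simp add: d_def powr_mult powr_divide)
  also have "\<eta> powr (1 - p) * \<eta> powr (p - 1) = 1"
    using \<open>\<eta> > 0\<close> by (simp flip: powr_add)
  finally have *: "d powr (1 - p) * N powr p \<le> (\<kappa> / C) powr (1 - p) * L powr p"
    by simp
  have "C * (X powr (p - 1) * N) \<le> C * (d * X powr p + d powr (1 - p) * N powr p)"
    using C powr_mult_le[OF p d X N] by (intro mult_left_mono) auto
  also have "\<dots> \<le> C * (d * X powr p + (\<kappa> / C) powr (1 - p) * L powr p)"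
    using C * by (intro mult_left_mono add_left_mono) auto
  also have "\<dots> = \<kappa> * X powr p * \<eta> + C * (\<kappa> / C) powr (1 - p) * L powr p"
    using C by (simp add: d_def field_simps)
  finally show ?thesis by (simp add: mult.assoc)
qed

section \<open>Nonexistence\<close>

lemma no_positive_supersolution:
  fixes H :: "'a::euclidean_space \<Rightarrow> real"
  assumes p: "1 < p"
    and H: "Ck_on 2 (- {0}) H" "continuous_on UNIV H"
    and hom: "\<And>t \<xi>. t > 0 \<Longrightarrow> H (t *\<^sub>R \<xi>) = t * H \<xi>"
    and pos: "\<And>\<xi>. \<xi> \<in> sphere 0 1 \<Longrightarrow> H \<xi> > 0"
    and f: "\<And>x. x > 0 \<Longrightarrow> f x > 0" "continuous_on {0<..} f"
      "Liminf (at_right 0) (\<lambda>x. ereal (f x)) > 0"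
    and super: "supersolution H p f u" and u_pos: "\<And>x. u x > 0"
  shows False
proof -
  define A where "A = aniso_flux H p"
  have flux: "A \<in> borel_measurable borel" "\<exists>c>0. \<forall>\<xi>. c * norm \<xi> powr p \<le> A \<xi> \<bullet> \<xi>"
    "\<exists>C>0. \<forall>\<xi>. norm (A \<xi>) \<le> C * norm \<xi> powr (p - 1)"
    unfolding A_def using hom pos by (blast intro: aniso_flux_bounds[OF H _ _ p])+
  obtain c1 where c1: "c1 > 0" "\<And>\<xi>. c1 * norm \<xi> powr p \<le> A \<xi> \<bullet> \<xi>"
    using flux(2) by auto
  obtain C where C: "C > 0" "\<And>\<xi>. norm (A \<xi>) \<le> C * norm \<xi> powr (p - 1)"
    using flux(3) by auto
  have u: "continuous_on UNIV u"
    using super by (simp add: supersolution_def)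
  have F: "continuous_on UNIV (\<lambda>x. f (u x))"
    using u_pos by (intro continuous_on_compose2[OF f(2) u]) auto
  obtain G where G: "G \<in> borel_measurable borel" "\<And>S. set_integrable lborel (cball 0 S) G"
    "\<And>S. set_integrable lborel (cball 0 S) (\<lambda>x. norm (G x) powr p)"
    "\<And>\<phi> b. test_function \<phi> \<Longrightarrow> b \<in> Basis \<Longrightarrow>
      (\<integral>x. u x * (gradient \<phi> x \<bullet> b) \<partial>lborel) = - (\<integral>x. (G x \<bullet> b) * \<phi> x \<partial>lborel)"
    "\<And>\<phi>. test_function \<phi> \<Longrightarrow> (\<And>x. 0 \<le> \<phi> x) \<Longrightarrow>
      (\<integral>x. f (u x) * \<phi> x \<partial>lborel) \<le> (\<integral>x. A (G x) \<bullet> gradient \<phi> x \<partial>lborel)"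
    using supersolution_borel_gradient[OF super flux(1)[unfolded A_def] F, folded A_def] by blast
  define k where "k = u 0 + 1"
  have k: "k > 0" using u_pos[of 0] by (simp add: k_def)
  obtain c0 where c0: "c0 > 0" "\<And>x. 0 < x \<Longrightarrow> x \<le> k \<Longrightarrow> c0 \<le> f x"
    using positive_lower_bound[OF f] by blast
  define w where "w x = smooth_step (k - u x)" for x
  have w: "0 \<le> w x" "w x \<le> 1" for x
    by (simp_all add: w_def)
  have w_cont: "continuous_on UNIV w"
    unfolding w_def[abs_def] using u
    by (intro continuous_on_compose2[OF continuous_on_smooth_step[of UNIV]] continuous_on_diff continuous_on_const) auto
  have "w 0 > 0"
    by (simp add: w_def k_def)
  define \<kappa> where "\<kappa> = c1 / k\<^sup>2"
  have \<kappa>: "\<kappa> > 0" using c1 k by (simp add: \<kappa>_def)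
  \<comment> \<open>The derivative of the step at t is its value divided by t^2, and positivity of
    \<open>u\<close> gives k - u x < k.\<close>
  have w_deriv: "w x / k\<^sup>2 \<le> smooth_step_deriv (k - u x)" for x
  proof (cases "u x < k")
    case True
    then have "(k - u x)\<^sup>2 \<le> k\<^sup>2"
      using u_pos[of x] by (intro power_mono) auto
    then show ?thesis
      using True k
      by (auto simp: w_def smooth_step_def smooth_step_deriv_def intro!: divide_left_mono mult_pos_pos)
  qed (simp add: w_def smooth_step_def smooth_step_deriv_def)
  have F_ge: "c0 * w x \<le> f (u x) * w x" for x
  proof (cases "u x < k")
    case True
    then show ?thesis
      using c0(2)[of "u x"] u_pos[of x] w(1)[of x] by (intro mult_right_mono) auto
  qed (simp add: w_def smooth_step_def)
  define \<eta> where "\<eta> r x = smooth_step (1 - (norm x / r)\<^sup>2)" for r and x :: 'a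
  define I where "I r = (\<integral>x. indicator (cball 0 r) x * w x \<partial>lborel)" for r
  have ind_int: "integrable lborel (\<lambda>x. indicator (cball 0 r) x * w x)" for r
    using borel_integrable_compact[OF compact_cball continuous_on_subset[OF w_cont subset_UNIV], of 0 r] by simp
  have \<eta>_int: "integrable lborel (\<lambda>x. w x * \<eta> r x)" if "r > 0" for r
  proof (rule integrable_continuous_vanishing[of _ r])
    show "continuous_on UNIV (\<lambda>x. w x * \<eta> r x)"
      unfolding \<eta>_def by (intro continuous_on_mult w_cont test_function_continuous test_function_radial_bump that)
    show "w x * \<eta> r x = 0" if "norm x > r" for x
      using radial_bump_vanishing[OF \<open>r > 0\<close>, of x] that by (simp add: \<eta>_def)
  qed
  define M where "M = C * (\<kappa> / C) powr (1 - p)"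
  have "M > 0" using C \<kappa> by (simp add: M_def)
  have energy: "c0 * (\<integral>x. w x * \<eta> r x \<partial>lborel) \<le> M * (4 * p\<^sup>2 / r) powr p * I r" if r: "r > 0" for r
  proof -
    have test: "test_function (\<eta> r)"
      unfolding \<eta>_def[abs_def] by (rule test_function_radial_bump[OF r])
    have \<eta>_nonneg: "0 \<le> \<eta> r x" for x
      by (simp add: \<eta>_def)
    define J where "J x = smooth_step (k - u x) * (A (G x) \<bullet> gradient (\<eta> r) x)
        - smooth_step_deriv (k - u x) * \<eta> r x * (A (G x) \<bullet> G x)" for x
    note truncated = truncated_test_inequality[OF u F p G(1) flux(1) G(2,3) _ C(2,1) _ test \<eta>_nonneg, of k]
    have J_int: "integrable lborel J"
      unfolding J_def[abs_def]
      by (rule truncated(1)) (rule G(4); assumption | rule G(5); blast)+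
    have J_ineq: "(\<integral>x. f (u x) * (w x * \<eta> r x) \<partial>lborel) \<le> (\<integral>x. J x \<partial>lborel)"
      unfolding J_def w_def
      by (rule truncated(2)) (rule G(4); assumption | rule G(5); blast)+
    \<comment> \<open>Absorption is carried out pointwise, before integrating, with
      \<open>w x\<close> as a common factor of both terms of \<open>J\<close>.\<close>
    have J_le: "J x \<le> M * (4 * p\<^sup>2 / r) powr p * (indicator (cball 0 r) x * w x)" for x
    proof -
      let ?X = "norm (G x)" and ?N = "norm (gradient (\<eta> r) x)"
      have N: "?N \<le> 4 * p\<^sup>2 / r * \<eta> r x powr ((p - 1) / p)"
        unfolding \<eta>_def[abs_def] by (rule norm_gradient_radial_bump_le[OF r p])
      have "A (G x) \<bullet> gradient (\<eta> r) x \<le> norm (A (G x)) * ?N"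
        by (rule norm_cauchy_schwarz)
      also have "\<dots> \<le> C * ?X powr (p - 1) * ?N"
        by (intro mult_right_mono C) simp
      finally have 1: "w x * (A (G x) \<bullet> gradient (\<eta> r) x) \<le> w x * (C * ?X powr (p - 1) * ?N)"
        using w(1) by (rule mult_left_mono)
      have "w x / k\<^sup>2 * \<eta> r x * (c1 * ?X powr p)
          \<le> smooth_step_deriv (k - u x) * \<eta> r x * (A (G x) \<bullet> G x)"
        using w_deriv w(1) \<eta>_nonneg c1 by (intro mult_mono) auto
      then have 2: "w x * (\<kappa> * ?X powr p * \<eta> r x)
          \<le> smooth_step_deriv (k - u x) * \<eta> r x * (A (G x) \<bullet> G x)"
        by (simp add: \<kappa>_def mult.assoc mult.left_commute mult.commute)
      have 3: "J x \<le> w x * (C * ?X powr (p - 1) * ?N - \<kappa> * ?X powr p * \<eta> r x)"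
        using 1 2 by (simp add: J_def w_def right_diff_distrib)
      show ?thesis
      \<comment> \<open>The absorbed remainder no longer contains the cutoff, so its localization to
        the ball must be restored by hand: outside, the bump and its gradient vanish.\<close>
      proof (cases "norm x \<le> r")
        case True
        have "w x * (C * ?X powr (p - 1) * ?N - \<kappa> * ?X powr p * \<eta> r x)
            \<le> w x * (M * (4 * p\<^sup>2 / r) powr p)"
          unfolding M_def using N r p by (intro mult_left_mono w absorb_gradient_term C \<kappa> \<eta>_nonneg) auto
        then show ?thesis
          using 3 True by (simp add: mult.commute)
      next
        case False
        then have "\<eta> r x = 0"
          using radial_bump_vanishing[OF r, of x] by (simp add: \<eta>_def)
        then have "?N = 0"
          using N by simp
        then show ?thesis
          using 3 False \<open>\<eta> r x = 0\<close> by simp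
      qed
    qed
    have F_int: "integrable lborel (\<lambda>x. f (u x) * (w x * \<eta> r x))"
    proof (rule integrable_continuous_vanishing[of _ r])
      show "continuous_on UNIV (\<lambda>x. f (u x) * (w x * \<eta> r x))"
        by (intro continuous_on_mult w_cont F test_function_continuous[OF test])
      show "f (u x) * (w x * \<eta> r x) = 0" if "norm x > r" for x
        using radial_bump_vanishing[OF r, of x] that by (simp add: \<eta>_def)
    qed
    have "c0 * (\<integral>x. w x * \<eta> r x \<partial>lborel) = (\<integral>x. c0 * (w x * \<eta> r x) \<partial>lborel)"
      by simp
    also have "\<dots> \<le> (\<integral>x. f (u x) * (w x * \<eta> r x) \<partial>lborel)"
      using mult_right_mono[OF F_ge \<eta>_nonneg]
      by (intro integral_mono integrable_mult_right \<eta>_int[OF r] F_int) (simp add: mult.assoc)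
    also have "\<dots> \<le> (\<integral>x. J x \<partial>lborel)"
      by (rule J_ineq)
    also have "\<dots> \<le> (\<integral>x. M * (4 * p\<^sup>2 / r) powr p * (indicator (cball 0 r) x * w x) \<partial>lborel)"
      by (intro integral_mono integrable_mult_right ind_int J_le J_int)
    also have "\<dots> = M * (4 * p\<^sup>2 / r) powr p * I r"
      unfolding I_def by simp
    finally show ?thesis .
  qed
  \<comment> \<open>The value of the bump of radius 2 r on the sphere of radius r, since 1 - (1/2)^2
    = 3/4; by monotonicity its minimum on the smaller ball.\<close>
  define m where "m = smooth_step (3 / 4)"
  have m: "m > 0" by (simp add: m_def)
  define K where "K = M * (4 * p\<^sup>2 / 2) powr p / (c0 * m)"
  have I_nonneg: "0 \<le> I r" for r
    unfolding I_def using w by (intro integral_nonneg_AE) auto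
  have decay: "I r \<le> K * r powr (- p) * I (2 * r)" if r: "r > 0" for r
  proof -
    have "m * I r = (\<integral>x. m * (indicator (cball 0 r) x * w x) \<partial>lborel)"
      unfolding I_def by simp
    also have "\<dots> \<le> (\<integral>x. w x * \<eta> (2 * r) x \<partial>lborel)"
    proof (intro integral_mono integrable_mult_right ind_int \<eta>_int)
      fix x
      show "m * (indicator (cball 0 r) x * w x) \<le> w x * \<eta> (2 * r) x"
      proof (cases "norm x \<le> r")
        case True
        then have "norm x / (2 * r) \<le> 1 / 2"
          using r by (simp add: field_simps)
        then have "(norm x / (2 * r))\<^sup>2 \<le> (1 / 2)\<^sup>2"
          using r by (intro power_mono) auto
        then have "m \<le> \<eta> (2 * r) x"
          unfolding m_def \<eta>_def by (intro smooth_step_mono) (simp add: power2_eq_square)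
        then show ?thesis
          using True mult_left_mono[OF _ w(1)[of x]] by (simp add: mult.commute[of m])
      qed (use w in \<open>simp add: \<eta>_def\<close>)
    qed (use r in auto)
    finally have "c0 * (m * I r) \<le> c0 * (\<integral>x. w x * \<eta> (2 * r) x \<partial>lborel)"
      using c0 by (intro mult_left_mono) auto
    also have "\<dots> \<le> M * (4 * p\<^sup>2 / (2 * r)) powr p * I (2 * r)"
      using r by (intro energy) auto
    also have "(4 * p\<^sup>2 / (2 * r)) powr p = (4 * p\<^sup>2 / 2) powr p * r powr (- p)"
      using r p by (simp add: powr_divide powr_minus_divide flip: divide_divide_eq_left)
    finally have "I r * (c0 * m) \<le> M * ((4 * p\<^sup>2 / 2) powr p * r powr (- p)) * I (2 * r)"
      by (simp only: mult_ac)
    then have "I r \<le> M * ((4 * p\<^sup>2 / 2) powr p * r powr (- p)) * I (2 * r) / (c0 * m)"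
      using c0(1) m by (simp add: pos_le_divide_eq)
    also have "\<dots> = K * r powr (- p) * I (2 * r)"
      by (simp add: K_def)
    finally show ?thesis .
  qed
  have growth: "I r \<le> unit_ball_vol (real DIM('a)) * r ^ DIM('a)" if r: "r > 0" for r
  proof -
    have "I r \<le> (\<integral>x. indicator (cball 0 r) x \<partial>(lborel :: 'a measure))"
      unfolding I_def
      using w by (intro integral_mono ind_int integrable_real_indicator emeasure_bounded_finite)
        (auto split: split_indicator)
    also have "\<dots> = unit_ball_vol (real DIM('a)) * r ^ DIM('a)"
      using r content_cball[of r "0::'a"] by simp
    finally show ?thesis .
  qed
  obtain R where R: "R > 0" "I R = 0"
  proof (rule superpolynomial_decay_imp_zero[OF I_nonneg growth decay])
    show "p > 0" using p by simp
  qed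
  \<comment> \<open>The energy estimate is used once more to pass from the indicator to the bump,
    whose product with \<open>w\<close> is continuous and positive at the origin.\<close>
  have "c0 * (\<integral>x. w x * \<eta> R x \<partial>lborel) \<le> 0"
    using energy[OF R(1)] R(2) by simp
  then have "(\<integral>x. w x * \<eta> R x \<partial>lborel) \<le> 0"
    using c0(1) by (simp add: mult_le_0_iff)
  moreover have nonneg: "0 \<le> w x * \<eta> R x" for x
    using w by (simp add: \<eta>_def)
  ultimately have "(\<integral>x. w x * \<eta> R x \<partial>lborel) = 0"
    by (intro antisym integral_nonneg_AE) auto
  then have "AE x in lborel. w x * \<eta> R x = 0"
    using integral_nonneg_eq_0_iff_AE[OF \<eta>_int[OF R(1)]] nonneg by simp
  moreover have "continuous_on UNIV (\<lambda>x. w x * \<eta> R x)"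
    unfolding \<eta>_def by (intro continuous_on_mult w_cont test_function_continuous test_function_radial_bump R)
  ultimately have "w 0 * \<eta> R 0 = 0"
    by (rule continuous_AE_eq_0_D[rotated])
  then show False
    using \<open>w 0 > 0\<close> by (simp add: \<eta>_def smooth_step_def)
qed

theorem corollary1p1:
  fixes H :: "real ^ 'n \<Rightarrow> real" and p :: real and f :: "real \<Rightarrow> real"
  assumes n: "CARD('n) \<ge> 2"
    and p: "1 < p" "p < real CARD('n)"
    and H_C2: "Ck_on 2 (- {0}) H"
    and H_cont: "continuous_on UNIV H"
    and H_hom: "\<And>t \<xi>. t > 0 \<Longrightarrow> H (t *\<^sub>R \<xi>) = t * H \<xi>"
    and H_zero: "H 0 = 0"
    and H_pos: "\<And>\<xi>. \<xi> \<in> sphere 0 1 \<Longrightarrow> H \<xi> > 0"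
    and H_convex: "uniformly_convex_unit_ball H"
    and f_pos: "\<And>x. x > 0 \<Longrightarrow> f x > 0"
    and f_cont: "continuous_on {0<..} f"
    and f_liminf: "Liminf (at_right 0) (\<lambda>x. ereal (f x)) > 0"
  shows "\<not> (\<exists>u. supersolution H p f u \<and> (\<forall>x. u x > 0))"
proof
  assume "\<exists>u. supersolution H p f u \<and> (\<forall>x. u x > 0)"
  then obtain u where "supersolution H p f u" "\<And>x. u x > 0"
    by blast
  then show False
    by (rule no_positive_supersolution[OF p(1) H_C2 H_cont _ _ _ f_cont f_liminf, rotated 3])
      (rule H_hom H_pos f_pos; assumption)+
qed

end
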